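(* Fix $n\geq 1$ and $a=(a_1,\dots,a_n)\in\mathbb{R}^n_{>0}$. Let $w_1,w_2,\dots$ be independent random letters in the alphabet $[n,\bar n]$, each with distribution $\rho$ given by $\rho(l)=a_l/\sum_{i=1}^n(a_i+a_i^{-1})$ and $\rho(\bar l)=a_l^{-1}/\sum_{i=1}^n(a_i+a_i^{-1})$ for $1\leq l\leq n$. Let $P(0)$ be the empty tableau and, for $m\geq 1$, let $P(m)$ be the symplectic tableau obtained by Berele-inserting $w_m$ into $P(m-1)$. Then the sequence of shapes $(\mathrm{sh}P(m))_{m\geq 0}$ is a Markov chain on $\Lambda_n$, started from the empty partition, with transition kernel \[\Pi(\mu,\lambda)=\frac{1}{\sum_{i=1}^n(a_i+a_i^{-1})}\,\frac{Sp^{(n)}_\lambda(a)}{Sp^{(n)}_\mu(a)}\,\mathbb{1}_{\mu\rightsquigarrow\lambda}.\]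
   Context: The alphabet $[n,\bar n]$ is the totally ordered set $1<\bar 1<2<\bar 2<\dots<n<\bar n$. A partition is a weakly decreasing sequence of nonnegative integers with finitely many nonzero terms; $\Lambda_n$ is the set of partitions with at most $n$ nonzero parts, identified with Young diagrams (left/top justified rows of boxes, row $i$ having $\lambda_i$ boxes). For partitions $\mu,\lambda$, $\mu\rightsquigarrow\lambda$ means $\lambda$ is obtained from $\mu$ by adding or deleting exactly one box. A symplectic tableau is a filling of a Young diagram with letters of $[n,\bar n]$ that is weakly increasing along rows, strictly increasing down columns, and such that no entry smaller than $i$ (i.e. no entry in $\{1,\bar 1,\dots,i-1,\overline{i-1}\}$) occurs in row $i$, for every $i$. Its shape $\mathrm{sh}P$ is the underlying partition. For a symplectic tableau $P$, $a^P=\prod_{l=1}^n a_l^{\#\{l\text{'s in }P\}-\#\{\bar l\text{'s in }P\}}$, and the symplectic Schur function is $Sp^{(n)}_\lambda(a)=\sum_{P:\ \mathrm{sh}P=\lambda}a^P$, the sum over symplectic tableaux with entries in $[n,\bar n]$. Jeu de taquin: given a tableau with one empty box at position (row $i$, column $j$), repeatedly do the following: if the empty box has both a right neighbour $t_{i,j+1}$ and a lower neighbour $t_{i+1,j}$, swap the empty box with $t_{i,j+1}$ if $t_{i,j+1}<t_{i+1,j}$ and with $t_{i+1,j}$ if $t_{i,j+1}\geq t_{i+1,j}$; if it has only one of these neighbours, swap with that one; when it has neither, delete the empty box. Berele insertion of a letter $c$ into a symplectic tableau $P$: start at row $r=1$. If $c$ is at least every entry of row $r$ (or the row is empty), append $c$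 at the end of row $r$ and stop. Otherwise let $b$ be the leftmost (i.e. smallest) entry of row $r$ strictly greater than $c$ and replace $b$ by $c$. If $c$ is the unbarred letter $r$ and $b=\bar r$, then (since $\bar r$ cannot be placed in row $r+1$) erase both: the box that held $b$ (now holding $c$) becomes empty, apply jeu de taquin, and stop. Otherwise set $c:=b$, $r:=r+1$ and repeat. *)

theory Defs
  imports "HOL-Probability.Probability"
begin

text \<open>Rows, columns and parts are indexed from 0: row \<open>i\<close> of the usual 1-based convention
  is \<open>P ! (i - 1)\<close>, the part \<open>\<lambda>\<^sub>i\<close> is \<open>\<lambda> (i - 1)\<close>. Letters keep their 1-based names.\<close>

datatype letter = Letter nat | Bar nat

text \<open>The order is \<open>Letter 1 < Bar 1 < Letter 2 < Bar 2 < \<dots>\<close>.\<close>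

fun letter_rank :: "letter \<Rightarrow> nat" where
  "letter_rank (Letter l) = 2 * l"
| "letter_rank (Bar l) = 2 * l + 1"

lemma letter_rank_inject: "letter_rank x = letter_rank y \<Longrightarrow> x = y"
  by (cases x; cases y) (simp_all, presburger+)

instantiation letter :: linorder
begin

definition less_eq_letter :: "letter \<Rightarrow> letter \<Rightarrow> bool" where
  "less_eq_letter x y \<longleftrightarrow> letter_rank x \<le> letter_rank y"

definition less_letter :: "letter \<Rightarrow> letter \<Rightarrow> bool" where
  "less_letter x y \<longleftrightarrow> letter_rank x < letter_rank y"

instance
  by standard (auto simp: less_eq_letter_def less_letter_def intro: letter_rank_inject)

end

definition alphabet :: "nat \<Rightarrow> letter set" where
  "alphabet n = Letter ` {1..n} \<union> Bar ` {1..n}"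

definition is_partition :: "(nat \<Rightarrow> nat) \<Rightarrow> bool" where
  "is_partition \<mu> \<longleftrightarrow> antimono \<mu> \<and> finite {i. \<mu> i \<noteq> 0}"

definition partitions_upto :: "nat \<Rightarrow> (nat \<Rightarrow> nat) set" where
  "partitions_upto n = {\<mu>. is_partition \<mu> \<and> card {i. \<mu> i \<noteq> 0} \<le> n}"

definition empty_partition :: "nat \<Rightarrow> nat" where
  "empty_partition = (\<lambda>_. 0)"

text \<open>Stated for arbitrary sequences and meant for two partitions: the relation does not
  itself require that \<open>\<mu>\<close> or \<open>\<nu>\<close> is weakly decreasing.\<close>

definition one_box_step :: "(nat \<Rightarrow> nat) \<Rightarrow> (nat \<Rightarrow> nat) \<Rightarrow> bool" where
  "one_box_step \<mu> \<nu> \<longleftrightarrow>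
     (\<exists>i. \<nu> = \<mu>(i := \<mu> i + 1)) \<or> (\<exists>i. 0 < \<mu> i \<and> \<nu> = \<mu>(i := \<mu> i - 1))"

text \<open>A filling is the list of its nonempty rows, so that equal fillings are equal lists.\<close>

type_synonym tableau = "letter list list"

definition shape :: "tableau \<Rightarrow> nat \<Rightarrow> nat" where
  "shape P = (\<lambda>i. if i < length P then length (P ! i) else 0)"

definition has_box :: "tableau \<Rightarrow> nat \<Rightarrow> nat \<Rightarrow> bool" where
  "has_box P i j \<longleftrightarrow> i < length P \<and> j < length (P ! i)"

definition symplectic_tableau :: "nat \<Rightarrow> tableau \<Rightarrow> bool" where
  "symplectic_tableau n P \<longleftrightarrow>
     (\<forall>row \<in> set P. row \<noteq> [] \<and> set row \<subseteq> alphabet n \<and> sorted row) \<and>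
     is_partition (shape P) \<and>
     (\<forall>i j. has_box P (Suc i) j \<longrightarrow> P ! i ! j < P ! Suc i ! j) \<and>
     (\<forall>i j. has_box P i j \<longrightarrow> Letter (Suc i) \<le> P ! i ! j)"

definition tableau_weight :: "nat \<Rightarrow> (nat \<Rightarrow> real) \<Rightarrow> tableau \<Rightarrow> real" where
  "tableau_weight n a P =
     (\<Prod>l = 1..n. a l powi (int (count_list (concat P) (Letter l)) -
                             int (count_list (concat P) (Bar l))))"

definition symplectic_schur :: "nat \<Rightarrow> (nat \<Rightarrow> nat) \<Rightarrow> (nat \<Rightarrow> real) \<Rightarrow> real" where
  "symplectic_schur n \<mu> a =
     (\<Sum>P \<in> {P. symplectic_tableau n P \<and> shape P = \<mu>}. tableau_weight n a P)"

definition delete_box :: "tableau \<Rightarrow> nat \<Rightarrow> tableau" where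
  "delete_box P i = filter (\<lambda>row. row \<noteq> []) (P[i := butlast (P ! i)])"

text \<open>In \<open>jeu_de_taquin P i j\<close> the box \<open>(i, j)\<close> is the empty one; the letter that the list
  still holds there is never read. When the slide stops, \<open>(i, j)\<close> is the last box of its row.\<close>

function jeu_de_taquin :: "tableau \<Rightarrow> nat \<Rightarrow> nat \<Rightarrow> tableau" where
  "jeu_de_taquin P i j =
     (if has_box P i (Suc j) \<and> (has_box P (Suc i) j \<longrightarrow> P ! i ! Suc j < P ! Suc i ! j)
      then jeu_de_taquin (P[i := (P ! i)[j := P ! i ! Suc j]]) i (Suc j)
      else if has_box P (Suc i) j
      then jeu_de_taquin (P[i := (P ! i)[j := P ! Suc i ! j]]) (Suc i) j
      else delete_box P i)"
  by pat_completeness auto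
termination
proof (relation "Wellfounded.measure (\<lambda>(P, i, j). (length P - i) + (sum_list (map length P) - j))", goal_cases)
  case 1
  show ?case by simp
next
  case (2 P i j)
  then have "i < length P" "Suc j < length (P ! i)"
    by (auto simp: has_box_def)
  moreover have "map length (P[i := (P ! i)[j := P ! i ! Suc j]]) = map length P"
    by (simp add: map_update list_update_same_conv)
      (metis list_update_id map_update)
  moreover have "length (P ! i) \<le> sum_list (map length P)"
    using \<open>i < length P\<close> by (intro member_le_sum_list) auto
  ultimately show ?case by simp
next
  case (3 P i j)
  then have "Suc i < length P"
    by (auto simp: has_box_def)
  moreover have "map length (P[i := (P ! i)[j := P ! Suc i ! j]]) = map length P"
    by (simp add: map_update list_update_same_conv)
      (metis list_update_id map_update)
  ultimately show ?case by simp
qed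

declare jeu_de_taquin.simps [simp del]

text \<open>In row \<open>r\<close>, which carries the 1-based number \<open>Suc r\<close>, the index \<open>j\<close> is that of the
  leftmost entry greater than \<open>c\<close>.\<close>

function berele_insert_from :: "nat \<Rightarrow> letter \<Rightarrow> tableau \<Rightarrow> tableau" where
  "berele_insert_from r c P =
     (if length P \<le> r then P @ [[c]]
      else if \<forall>x \<in> set (P ! r). x \<le> c then P[r := P ! r @ [c]]
      else let j = length (takeWhile (\<lambda>x. x \<le> c) (P ! r)); b = P ! r ! j
        in if c = Letter (Suc r) \<and> b = Bar (Suc r) then jeu_de_taquin P r j
           else berele_insert_from (Suc r) b (P[r := (P ! r)[j := c]]))"
  by pat_completeness auto
termination
  by (relation "Wellfounded.measure (\<lambda>(r, c, P). length P - r)") auto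

declare berele_insert_from.simps [simp del]

definition berele_insert :: "letter \<Rightarrow> tableau \<Rightarrow> tableau" where
  "berele_insert c P = berele_insert_from 0 c P"

text \<open>\<open>w 0\<close> is not used: the word is \<open>w 1, w 2, \<dots>\<close>.\<close>

primrec berele_tableau :: "(nat \<Rightarrow> letter) \<Rightarrow> nat \<Rightarrow> tableau" where
  "berele_tableau w 0 = []"
| "berele_tableau w (Suc m) = berele_insert (w (Suc m)) (berele_tableau w m)"

definition letter_norm :: "nat \<Rightarrow> (nat \<Rightarrow> real) \<Rightarrow> real" where
  "letter_norm n a = (\<Sum>i = 1..n. a i + inverse (a i))"

fun letter_prob :: "nat \<Rightarrow> (nat \<Rightarrow> real) \<Rightarrow> letter \<Rightarrow> real" where
  "letter_prob n a (Letter l) = a l / letter_norm n a"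
| "letter_prob n a (Bar l) = inverse (a l) / letter_norm n a"

definition shape_kernel :: "nat \<Rightarrow> (nat \<Rightarrow> real) \<Rightarrow> (nat \<Rightarrow> nat) \<Rightarrow> (nat \<Rightarrow> nat) \<Rightarrow> real" where
  "shape_kernel n a \<mu> \<nu> =
     1 / letter_norm n a * (symplectic_schur n \<nu> a / symplectic_schur n \<mu> a) *
     of_bool (one_box_step \<mu> \<nu>)"

definition stochastic_kernel_on :: "'s set \<Rightarrow> ('s \<Rightarrow> 's \<Rightarrow> real) \<Rightarrow> bool" where
  "stochastic_kernel_on S K \<longleftrightarrow>
     (\<forall>x \<in> S. (\<forall>y \<in> S. 0 \<le> K x y) \<and> (K x has_sum 1) S)"

definition markov_chain_on ::
  "'w measure \<Rightarrow> 's set \<Rightarrow> ('s \<Rightarrow> 's \<Rightarrow> real) \<Rightarrow> 's \<Rightarrow> (nat \<Rightarrow> 'w \<Rightarrow> 's) \<Rightarrow> bool" where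
  "markov_chain_on M S K x0 X \<longleftrightarrow>
     stochastic_kernel_on S K \<and>
     (\<forall>m. X m \<in> measurable M (count_space S)) \<and>
     \<P>(\<omega> in M. X 0 \<omega> = x0) = 1 \<and>
     (\<forall>m x. \<forall>y \<in> S. \<P>(\<omega> in M. \<forall>k \<le> m. X k \<omega> = x k) > 0 \<longrightarrow>
        \<P>(\<omega> in M. X (Suc m) \<omega> = y \<bar> \<forall>k \<le> m. X k \<omega> = x k) = K (x m) y)"

end

theory Submission
  imports Defs
begin

text \<open>For fixed \<open>\<mu>\<close>, Berele insertion is a bijection from pairs (letter, tableau of shape \<open>\<mu>\<close>) onto the
  symplectic tableaux whose shape differs from \<open>\<mu>\<close> by one box, and it multiplies weights. Bijectivity
  holds because every bumping, cancelling and sliding step can be undone, and the state before the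
  step is determined by the state after it. Consequently the joint probability of a path of shapes
  and of its last tableau \<open>P\<close> is proportional to \<open>a\<^sup>P\<close>, with a factor depending on the path only.
  Summing over \<open>P\<close> gives the transition probabilities; the kernel is stochastic because the
  bijection yields \<open>\<Sum>\<^sub>\<nu> Sp\<^sub>\<nu> = (\<Sum>\<^sub>i a\<^sub>i + a\<^sub>i\<^sup>-\<^sup>1) Sp\<^sub>\<mu>\<close>, summed over the neighbours \<open>\<nu>\<close> of \<open>\<mu>\<close>.\<close>

subsection \<open>Insertion as a sequence of reversible steps\<close>

text \<open>How the predecessor of a state is found: a final shape larger than \<mu> comes from an
  appended box, a smaller one from a finished slide. An insertion into a row below the top one comes
  from a bump, undone at the rightmost smaller letter of the row above. For a hole, the left and the
  upper neighbour compete, and the larger one, or the upper one in a tie, was the last to move. In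
  the first column only the upper neighbour can have moved, but the slide may also have begun there.
  The row bound thus has two roles: it triggers cancellations, and it marks where a backward slide
  has to stop. As one of these alternatives always applies, a backward run gets stuck only at the
  start of an insertion. All steps but the last keep the diagram \<mu>, with a hole where necessary;
  only the last one changes the shape. A rank that grows with every step between non-final states
  bounds the runs in both directions.\<close>

text \<open>The boxes in \<open>H\<close> are holes; there and outside the diagram \<open>t\<close> takes the junk value
  \<^term>\<open>Letter 0\<close>, which makes \<open>t\<close> unique for a given tableau.\<close>

definition filling :: "nat \<Rightarrow> (nat \<times> nat) set \<Rightarrow> (nat \<Rightarrow> nat) \<Rightarrow> (nat \<times> nat \<Rightarrow> letter) \<Rightarrow> bool" where
  "filling n H \<mu> t \<longleftrightarrow>
     (\<forall>i j. j < \<mu> i \<longrightarrow> (i, j) \<notin> H \<longrightarrow> t (i, j) \<in> alphabet n \<and> Letter (Suc i) \<le> t (i, j)) \<and>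
     (\<forall>i j j'. j < j' \<longrightarrow> j' < \<mu> i \<longrightarrow> (i, j) \<notin> H \<longrightarrow> (i, j') \<notin> H \<longrightarrow> t (i, j) \<le> t (i, j')) \<and>
     (\<forall>i i' j. i < i' \<longrightarrow> j < \<mu> i' \<longrightarrow> (i, j) \<notin> H \<longrightarrow> (i', j) \<notin> H \<longrightarrow> t (i, j) < t (i', j)) \<and>
     (\<forall>i j. \<mu> i \<le> j \<or> (i, j) \<in> H \<longrightarrow> t (i, j) = Letter 0)"

lemma fillingI:
  assumes "\<And>i j. j < \<mu> i \<Longrightarrow> (i, j) \<notin> H \<Longrightarrow> t (i, j) \<in> alphabet n"
    and "\<And>i j. j < \<mu> i \<Longrightarrow> (i, j) \<notin> H \<Longrightarrow> Letter (Suc i) \<le> t (i, j)"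
    and "\<And>i j j'. j < j' \<Longrightarrow> j' < \<mu> i \<Longrightarrow> (i, j) \<notin> H \<Longrightarrow> (i, j') \<notin> H \<Longrightarrow> t (i, j) \<le> t (i, j')"
    and "\<And>i i' j. i < i' \<Longrightarrow> j < \<mu> i' \<Longrightarrow> (i, j) \<notin> H \<Longrightarrow> (i', j) \<notin> H \<Longrightarrow> t (i, j) < t (i', j)"
    and "\<And>i j. \<mu> i \<le> j \<or> (i, j) \<in> H \<Longrightarrow> t (i, j) = Letter 0"
  shows "filling n H \<mu> t"
  using assms unfolding filling_def by blast

lemma filling_alphabet: "filling n H \<mu> t \<Longrightarrow> j < \<mu> i \<Longrightarrow> (i, j) \<notin> H \<Longrightarrow> t (i, j) \<in> alphabet n"
  and filling_ge: "filling n H \<mu> t \<Longrightarrow> j < \<mu> i \<Longrightarrow> (i, j) \<notin> H \<Longrightarrow> Letter (Suc i) \<le> t (i, j)"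
  and filling_row: "filling n H \<mu> t \<Longrightarrow> j < j' \<Longrightarrow> j' < \<mu> i \<Longrightarrow> (i, j) \<notin> H \<Longrightarrow> (i, j') \<notin> H
    \<Longrightarrow> t (i, j) \<le> t (i, j')"
  and filling_col: "filling n H \<mu> t \<Longrightarrow> i < i' \<Longrightarrow> j < \<mu> i' \<Longrightarrow> (i, j) \<notin> H \<Longrightarrow> (i', j) \<notin> H
    \<Longrightarrow> t (i, j) < t (i', j)"
  and filling_outside: "filling n H \<mu> t \<Longrightarrow> \<mu> i \<le> j \<or> (i, j) \<in> H \<Longrightarrow> t (i, j) = Letter 0"
  unfolding filling_def by blast+

lemma partition_mono: "is_partition \<mu> \<Longrightarrow> i \<le> i' \<Longrightarrow> \<mu> i' \<le> \<mu> i"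
  unfolding is_partition_def by (blast dest: antimonoD)

lemma Letter_less_Suc: "x < Letter (Suc (Suc i)) \<Longrightarrow> Letter (Suc i) \<le> x \<Longrightarrow> x = Letter (Suc i) \<or> x = Bar (Suc i)"
  by (cases x) (auto simp: less_eq_letter_def less_letter_def)

lemma Letter_ge_simps:
  "Letter (Suc i) \<le> Bar (Suc i)" "Letter (Suc i) < Bar (Suc i)" "Bar (Suc i) < Letter (Suc (Suc i))"
  "Letter (Suc i) < Letter (Suc (Suc i))" "Letter 0 \<le> x"
  by (auto simp: less_eq_letter_def less_letter_def)

text \<open>In \<open>Ins r c t\<close> the letter \<open>c\<close> is about to enter row
  \<open>r\<close>; in \<open>Slide i j t\<close> the hole is at \<open>(i, j)\<close>;
  \<open>Done\<close> is the outcome. The first two live on the initial diagram, so only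
  \<open>Done\<close> carries a shape.\<close>

datatype state =
    Ins nat letter "nat \<times> nat \<Rightarrow> letter"
  | Slide nat nat "nat \<times> nat \<Rightarrow> letter"
  | Done "nat \<Rightarrow> nat" "nat \<times> nat \<Rightarrow> letter"

text \<open>A cancellation moves the hole to the first column at once: the boxes to its left all contain
  \<open>Letter (Suc r)\<close>, so the slide from there passes through the original hole. A slide coming from
  a cancellation in row \<open>r\<close> can then be recognised backwards: the hole is in the first column and
  the letter above it may not enter row \<open>r\<close>.\<close>

inductive step :: "(nat \<Rightarrow> nat) \<Rightarrow> state \<Rightarrow> state \<Rightarrow> bool" for \<mu> where
  bump: "k < \<mu> r \<Longrightarrow> \<forall>j<k. t (r, j) \<le> c \<Longrightarrow> c < t (r, k) \<Longrightarrow> t (r, k) \<noteq> Bar (Suc r) \<Longrightarrow>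
    step \<mu> (Ins r c t) (Ins (Suc r) (t (r, k)) (t((r, k) := c)))"
| append: "\<forall>j<\<mu> r. t (r, j) \<le> c \<Longrightarrow>
    step \<mu> (Ins r c t) (Done (\<mu>(r := Suc (\<mu> r))) (t((r, \<mu> r) := c)))"
| cancel: "k < \<mu> r \<Longrightarrow> \<forall>j<k. t (r, j) = Letter (Suc r) \<Longrightarrow> t (r, k) = Bar (Suc r) \<Longrightarrow>
    step \<mu> (Ins r (Letter (Suc r)) t) (Slide r 0 (t((r, k) := Letter (Suc r), (r, 0) := Letter 0)))"
| right: "Suc j < \<mu> i \<Longrightarrow> j < \<mu> (Suc i) \<longrightarrow> t (i, Suc j) < t (Suc i, j) \<Longrightarrow>
    step \<mu> (Slide i j t) (Slide i (Suc j) (t((i, j) := t (i, Suc j), (i, Suc j) := Letter 0)))"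
| down: "j < \<mu> (Suc i) \<Longrightarrow> Suc j < \<mu> i \<longrightarrow> t (Suc i, j) \<le> t (i, Suc j) \<Longrightarrow>
    step \<mu> (Slide i j t) (Slide (Suc i) j (t((i, j) := t (Suc i, j), (Suc i, j) := Letter 0)))"
| finish: "Suc j = \<mu> i \<Longrightarrow> \<mu> (Suc i) \<le> j \<Longrightarrow>
    step \<mu> (Slide i j t) (Done (\<mu>(i := j)) t)"

text \<open>The witness \<open>k\<close> is the column of the row above from which \<open>c\<close>
  was bumped: the letter now there is smaller than \<open>c\<close>, and the letter below it is
  larger. Mere existence is enough, because undoing the bump recovers a column from the
  filling.\<close>

fun valid :: "nat \<Rightarrow> (nat \<Rightarrow> nat) \<Rightarrow> state \<Rightarrow> bool" where
  "valid n \<mu> (Ins r c t) \<longleftrightarrow> filling n {} \<mu> t \<and> c \<in> alphabet n \<and> Letter (Suc r) \<le> c \<and>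
     (\<forall>i. r = Suc i \<longrightarrow> (\<exists>k<\<mu> i. t (i, k) < c \<and> (k < \<mu> r \<longrightarrow> c < t (r, k))))"
| "valid n \<mu> (Slide i j t) \<longleftrightarrow> j < \<mu> i \<and> filling n {(i, j)} \<mu> t"
| "valid n \<mu> (Done \<nu> t) \<longleftrightarrow> is_partition \<nu> \<and> one_box_step \<mu> \<nu> \<and> filling n {} \<nu> t"

section \<open>Forward steps: validity is preserved, and some step always applies\<close>

lemma filling_row_le: "filling n {} \<mu> t \<Longrightarrow> j \<le> j' \<Longrightarrow> j' < \<mu> i \<Longrightarrow> t (i, j) \<le> t (i, j')"
  by (cases "j = j'") (auto intro: filling_row)

text \<open>Bumping moves weakly to the left: \<open>c\<close> is smaller than the letter of row
  \<open>r\<close> in the column \<open>l\<close> it was bumped from, so its place \<open>k\<close>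
  satisfies \<open>k \<le> l\<close>. Hence there are boxes above place \<open>k\<close>, and their
  letters are bounded by the one in column \<open>l\<close> of the row above, which is smaller than
  \<open>c\<close>.\<close>

lemma insertion_above:
  assumes v: "valid n \<mu> (Ins r c t)" and p: "is_partition \<mu>"
    and k: "\<forall>j<k. t (r, j) \<le> c" "k \<le> \<mu> r" and i: "i < r"
  shows "k < \<mu> i" "t (i, k) < c"
proof -
  obtain r' where r: "r = Suc r'" using i by (cases r) auto
  obtain l where l: "l < \<mu> r'" "t (r', l) < c" "l < \<mu> r \<longrightarrow> c < t (r, l)"
    using v r by auto
  have f: "filling n {} \<mu> t" using v by simp
  have "k \<le> l" using l k by (meson leD leI less_le_trans)
  then have k': "k < \<mu> r'" using l by simp
  moreover have "\<mu> r' \<le> \<mu> i" using p i r by (auto intro: partition_mono)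
  ultimately show "k < \<mu> i" by simp
  have "t (r', k) < c" using filling_row_le[OF f \<open>k \<le> l\<close> l(1)] l(2) by simp
  moreover have "t (i, k) \<le> t (r', k)"
    using filling_col[OF f, of i r' k] k' i r by (cases "i = r'") auto
  ultimately show "t (i, k) < c" by simp
qed

lemma valid_bump:
  assumes p: "is_partition \<mu>" and v: "valid n \<mu> (Ins r c t)"
    and k: "k < \<mu> r" "\<forall>j<k. t (r, j) \<le> c" "c < t (r, k)" "t (r, k) \<noteq> Bar (Suc r)"
  shows "valid n \<mu> (Ins (Suc r) (t (r, k)) (t((r, k) := c)))"
proof -
  have f: "filling n {} \<mu> t" and c: "c \<in> alphabet n" "Letter (Suc r) \<le> c" using v by auto
  have above: "t (i, k) < c" if "i < r" for i
    using insertion_above[OF v p, of k i] k that by auto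
  have f': "filling n {} \<mu> (t((r, k) := c))"
  proof (rule fillingI)
    fix i j j' assume "j < j'" "j' < \<mu> i"
    then show "(t((r, k) := c)) (i, j) \<le> (t((r, k) := c)) (i, j')"
      using filling_row[OF f, of j j' i] k by auto
  next
    fix i i' j assume "i < i'" "j < \<mu> i'"
    then show "(t((r, k) := c)) (i, j) < (t((r, k) := c)) (i', j)"
      using filling_col[OF f, of i i' j] k above[of i] by auto
  qed (use f c k in \<open>auto intro: filling_alphabet filling_ge filling_outside\<close>)
  \<comment> \<open>The next row admits the bumped letter: of the two letters allowed in row
    \<open>r\<close> but not below, \<open>Letter (Suc r)\<close> is excluded by strictness and
    \<open>Bar (Suc r)\<close> by hypothesis. The vacated column \<open>k\<close> is the new
    witness.\<close>
  have "Letter (Suc r) < t (r, k)" using c k by (auto intro: le_less_trans)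
  then have "\<not> t (r, k) < Letter (Suc (Suc r))"
    using Letter_less_Suc[of "t (r, k)" r] k(4) by (metis less_imp_le less_irrefl)
  moreover have "\<exists>l<\<mu> r. (t((r, k) := c)) (r, l) < t (r, k) \<and>
      (l < \<mu> (Suc r) \<longrightarrow> t (r, k) < (t((r, k) := c)) (Suc r, l))"
    using k filling_col[OF f, of r "Suc r" k] by (intro exI[of _ k]) auto
  ultimately show ?thesis
    using f' f k by (auto intro: filling_alphabet)
qed

lemma valid_append:
  assumes p: "is_partition \<mu>" and v: "valid n \<mu> (Ins r c t)" and k: "\<forall>j<\<mu> r. t (r, j) \<le> c"
  shows "valid n \<mu> (Done (\<mu>(r := Suc (\<mu> r))) (t((r, \<mu> r) := c)))"
proof -
  have f: "filling n {} \<mu> t" and c: "c \<in> alphabet n" "Letter (Suc r) \<le> c" using v by auto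
  \<comment> \<open>Taking the end of row \<open>r\<close> as the place of \<open>c\<close> also
    shows that all rows above are longer, so the new shape is a partition.\<close>
  have above: "\<mu> r < \<mu> i" "t (i, \<mu> r) < c" if "i < r" for i
    using insertion_above[OF v p k, of i] that by auto
  have "antimono (\<mu>(r := Suc (\<mu> r)))"
  proof (rule antimonoI)
    fix i i' :: nat assume "i \<le> i'"
    then show "(\<mu>(r := Suc (\<mu> r))) i' \<le> (\<mu>(r := Suc (\<mu> r))) i"
      using partition_mono[OF p, of i i'] above(1)[of i] by auto
  qed
  moreover have "finite {i. (\<mu>(r := Suc (\<mu> r))) i \<noteq> 0}"
    by (rule finite_subset[of _ "insert r {i. \<mu> i \<noteq> 0}"]) (use p in \<open>auto simp: is_partition_def\<close>)
  moreover have "filling n {} (\<mu>(r := Suc (\<mu> r))) (t((r, \<mu> r) := c))"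
  proof (rule fillingI)
    fix i j j' assume "j < j'" "j' < (\<mu>(r := Suc (\<mu> r))) i"
    then show "(t((r, \<mu> r) := c)) (i, j) \<le> (t((r, \<mu> r) := c)) (i, j')"
      using filling_row[OF f, of j j' i] k by (auto split: if_splits)
  next
    fix i i' j assume "i < i'" "j < (\<mu>(r := Suc (\<mu> r))) i'"
    then show "(t((r, \<mu> r) := c)) (i, j) < (t((r, \<mu> r) := c)) (i', j)"
      using filling_col[OF f, of i i' j] above(2)[of i] partition_mono[OF p, of r i']
      by (auto split: if_splits simp: less_Suc_eq)
  next
    fix i j assume "(\<mu>(r := Suc (\<mu> r))) i \<le> j \<or> (i, j) \<in> {}"
    then show "(t((r, \<mu> r) := c)) (i, j) = Letter 0"
      using filling_outside[OF f, of i j] by (auto split: if_splits)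
  next
    fix i j assume "j < (\<mu>(r := Suc (\<mu> r))) i"
    then show "(t((r, \<mu> r) := c)) (i, j) \<in> alphabet n" "Letter (Suc i) \<le> (t((r, \<mu> r) := c)) (i, j)"
      using filling_alphabet[OF f, of j i] filling_ge[OF f, of j i] c
      by (auto split: if_splits simp: less_Suc_eq)
  qed
  moreover have "one_box_step \<mu> (\<mu>(r := Suc (\<mu> r)))"
    unfolding one_box_step_def by auto
  ultimately show ?thesis by (simp add: is_partition_def)
qed

text \<open>Apart from the hole, only box \<open>k\<close> changes, from \<open>Bar (Suc r)\<close>
  to the smaller \<open>Letter (Suc r)\<close>. The danger is the column above it, and there the
  history of the insertion is used.\<close>

lemma valid_cancel:
  assumes p: "is_partition \<mu>" and v: "valid n \<mu> (Ins r (Letter (Suc r)) t)"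
    and k: "k < \<mu> r" "\<forall>j<k. t (r, j) = Letter (Suc r)" "t (r, k) = Bar (Suc r)"
  shows "valid n \<mu> (Slide r 0 (t((r, k) := Letter (Suc r), (r, 0) := Letter 0)))"
proof -
  let ?t = "t((r, k) := Letter (Suc r), (r, 0) := Letter 0)"
  have f: "filling n {} \<mu> t" and c: "Letter (Suc r) \<in> alphabet n" using v by auto
  have above: "t (i, k) < Letter (Suc r)" if "i < r" for i
    using insertion_above[OF v p, of k i] k that by auto
  have "filling n {(r, 0)} \<mu> ?t"
  proof (rule fillingI)
    fix i j j' assume "j < j'" "j' < \<mu> i" "(i, j) \<notin> {(r, 0)}" "(i, j') \<notin> {(r, 0)}"
    then show "?t (i, j) \<le> ?t (i, j')"
      using filling_row[OF f, of j j' i] filling_ge[OF f, of j' i] k by auto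
  next
    fix i i' j assume "i < i'" "j < \<mu> i'" "(i, j) \<notin> {(r, 0)}" "(i', j) \<notin> {(r, 0)}"
    then show "?t (i, j) < ?t (i', j)"
      using filling_col[OF f, of i i' j] k above[of i] Letter_ge_simps(2)[of r]
      by auto
  next
    fix i j assume "\<mu> i \<le> j \<or> (i, j) \<in> {(r, 0)}"
    then show "?t (i, j) = Letter 0"
      using filling_outside[OF f, of i j] k by auto
  qed (use f c k in \<open>auto intro: filling_alphabet filling_ge\<close>)
  then show ?thesis using k by auto
qed

text \<open>The letter moving left exceeds those above the hole because it exceeds their right
  neighbours; it stays below those under the hole by the strict inequality of the sliding
  rule.\<close>

lemma valid_right:
  assumes p: "is_partition \<mu>" and v: "valid n \<mu> (Slide i j t)"
    and s: "Suc j < \<mu> i" "j < \<mu> (Suc i) \<longrightarrow> t (i, Suc j) < t (Suc i, j)"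
  shows "valid n \<mu> (Slide i (Suc j) (t((i, j) := t (i, Suc j), (i, Suc j) := Letter 0)))"
proof -
  let ?t = "t((i, j) := t (i, Suc j), (i, Suc j) := Letter 0)"
  have f: "filling n {(i, j)} \<mu> t" using v by auto
  have above: "t (i1, j) < t (i, Suc j)" if "i1 < i" for i1
  proof -
    have "Suc j < \<mu> i1" using partition_mono[OF p, of i1 i] s that by simp
    then show ?thesis
      using filling_row[OF f, of j "Suc j" i1] filling_col[OF f, of i1 i "Suc j"] that s by auto
  qed
  have below: "t (i, Suc j) < t (i1, j)" if "i < i1" "j < \<mu> i1" for i1
  proof -
    have "j < \<mu> (Suc i)" using partition_mono[OF p, of "Suc i" i1] that by simp
    then show ?thesis
      using filling_col[OF f, of "Suc i" i1 j] that s by (cases "i1 = Suc i") auto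
  qed
  have "filling n {(i, Suc j)} \<mu> ?t"
  proof (rule fillingI)
    fix i1 j1 j2 assume "j1 < j2" "j2 < \<mu> i1" "(i1, j1) \<notin> {(i, Suc j)}" "(i1, j2) \<notin> {(i, Suc j)}"
    then show "?t (i1, j1) \<le> ?t (i1, j2)"
      using filling_row[OF f, of j1 j2 i1] filling_row[OF f, of "Suc j" j2 i1]
        filling_row[OF f, of j1 "Suc j" i1] s by auto
  next
    fix i1 i2 j1 assume "i1 < i2" "j1 < \<mu> i2" "(i1, j1) \<notin> {(i, Suc j)}" "(i2, j1) \<notin> {(i, Suc j)}"
    then show "?t (i1, j1) < ?t (i2, j1)"
      using filling_col[OF f, of i1 i2 j1] above[of i1] below[of i2] by auto
  next
    fix i1 j1 assume "\<mu> i1 \<le> j1 \<or> (i1, j1) \<in> {(i, Suc j)}"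
    then show "?t (i1, j1) = Letter 0"
      using filling_outside[OF f, of i1 j1] s by auto
  next
    fix i1 j1 assume "j1 < \<mu> i1" "(i1, j1) \<notin> {(i, Suc j)}"
    then show "?t (i1, j1) \<in> alphabet n" "Letter (Suc i1) \<le> ?t (i1, j1)"
      using filling_alphabet[OF f, of j1 i1] filling_ge[OF f, of j1 i1]
        filling_alphabet[OF f, of "Suc j" i] filling_ge[OF f, of "Suc j" i] s by auto
  qed
  then show ?thesis using s by auto
qed

text \<open>The rising letter is at least the letters left of the hole, by way of the letters under
  them, and at most those to the right by the sliding rule; ties are harmless since rows increase
  weakly. A letter allowed in one row is allowed in the row above.\<close>

lemma valid_down:
  assumes p: "is_partition \<mu>" and v: "valid n \<mu> (Slide i j t)"
    and s: "j < \<mu> (Suc i)" "Suc j < \<mu> i \<longrightarrow> t (Suc i, j) \<le> t (i, Suc j)"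
  shows "valid n \<mu> (Slide (Suc i) j (t((i, j) := t (Suc i, j), (Suc i, j) := Letter 0)))"
proof -
  let ?t = "t((i, j) := t (Suc i, j), (Suc i, j) := Letter 0)"
  have f: "filling n {(i, j)} \<mu> t" using v by auto
  have left: "t (i, j1) \<le> t (Suc i, j)" if "j1 < j" for j1
    using filling_col[OF f, of i "Suc i" j1] filling_row[OF f, of j1 j "Suc i"] that s by auto
  have rght: "t (Suc i, j) \<le> t (i, j1)" if "j < j1" "j1 < \<mu> i" for j1
    using filling_row[OF f, of "Suc j" j1 i] that s by (cases "j1 = Suc j") auto
  have "filling n {(Suc i, j)} \<mu> ?t"
  proof (rule fillingI)
    fix i1 j1 j2 assume "j1 < j2" "j2 < \<mu> i1" "(i1, j1) \<notin> {(Suc i, j)}" "(i1, j2) \<notin> {(Suc i, j)}"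
    then show "?t (i1, j1) \<le> ?t (i1, j2)"
      using filling_row[OF f, of j1 j2 i1] left[of j1] rght[of j2] s by auto
  next
    fix i1 i2 j1 assume "i1 < i2" "j1 < \<mu> i2" "(i1, j1) \<notin> {(Suc i, j)}" "(i2, j1) \<notin> {(Suc i, j)}"
    then show "?t (i1, j1) < ?t (i2, j1)"
      using filling_col[OF f, of i1 i2 j1] filling_col[OF f, of i1 "Suc i" j1]
         filling_col[OF f, of "Suc i" i2 j1] s by auto
  next
    fix i1 j1 assume "\<mu> i1 \<le> j1 \<or> (i1, j1) \<in> {(Suc i, j)}"
    then show "?t (i1, j1) = Letter 0"
      using filling_outside[OF f, of i1 j1] s v by auto
  next
    fix i1 j1 assume "j1 < \<mu> i1" "(i1, j1) \<notin> {(Suc i, j)}"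
    then show "?t (i1, j1) \<in> alphabet n" "Letter (Suc i1) \<le> ?t (i1, j1)"
      using filling_alphabet[OF f, of j1 i1] filling_ge[OF f, of j1 i1]
        filling_alphabet[OF f, of j "Suc i"] filling_ge[OF f, of j "Suc i"] s
        Letter_ge_simps(4)[of i] by auto
  qed
  then show ?thesis using s by auto
qed

lemma valid_finish:
  assumes p: "is_partition \<mu>" and v: "valid n \<mu> (Slide i j t)"
    and s: "Suc j = \<mu> i" "\<mu> (Suc i) \<le> j"
  shows "valid n \<mu> (Done (\<mu>(i := j)) t)"
proof -
  have f: "filling n {(i, j)} \<mu> t" using v by auto
  have "antimono (\<mu>(i := j))"
  proof (rule antimonoI)
    fix i1 i2 :: nat assume "i1 \<le> i2"
    then show "(\<mu>(i := j)) i2 \<le> (\<mu>(i := j)) i1"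
      using partition_mono[OF p, of i1 i2] partition_mono[OF p, of "Suc i" i2] s by auto
  qed
  moreover have "finite {i'. (\<mu>(i := j)) i' \<noteq> 0}"
    by (rule finite_subset[of _ "insert i {i. \<mu> i \<noteq> 0}"]) (use p in \<open>auto simp: is_partition_def\<close>)
  moreover have "filling n {} (\<mu>(i := j)) t"
  proof (rule fillingI)
    fix i1 j1 j2 assume "j1 < j2" "j2 < (\<mu>(i := j)) i1"
    then show "t (i1, j1) \<le> t (i1, j2)"
      using filling_row[OF f, of j1 j2 i1] s by (auto split: if_splits)
  next
    fix i1 i2 j1 assume a: "i1 < i2" "j1 < (\<mu>(i := j)) i2"
    then have "(i1, j1) \<noteq> (i, j)"
      using partition_mono[OF p, of "Suc i" i2] s by (auto split: if_splits)
    then show "t (i1, j1) < t (i2, j1)"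
      using filling_col[OF f, of i1 i2 j1] s a by (auto split: if_splits)
  next
    fix i1 j1 assume "(\<mu>(i := j)) i1 \<le> j1 \<or> (i1, j1) \<in> {}"
    then show "t (i1, j1) = Letter 0"
      using filling_outside[OF f, of i1 j1] s by (cases "j1 = j") (auto split: if_splits)
  next
    fix i1 j1 assume "j1 < (\<mu>(i := j)) i1"
    then show "t (i1, j1) \<in> alphabet n" "Letter (Suc i1) \<le> t (i1, j1)"
      using filling_alphabet[OF f, of j1 i1] filling_ge[OF f, of j1 i1] s
      by (auto split: if_splits)
  qed
  moreover have "\<mu>(i := j) = \<mu>(i := \<mu> i - 1)" "0 < \<mu> i" using s(1)[symmetric] by auto
  then have "one_box_step \<mu> (\<mu>(i := j))" unfolding one_box_step_def by blast
  ultimately show ?thesis by (simp add: is_partition_def)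
qed

lemma valid_step:
  assumes "is_partition \<mu>" "valid n \<mu> s" "step \<mu> s s'"
  shows "valid n \<mu> s'"
  using assms(3,2)
proof cases
  case bump then show ?thesis using valid_bump assms by blast
next
  case append then show ?thesis using valid_append assms by blast
next
  case cancel then show ?thesis using valid_cancel assms by blast
next
  case right then show ?thesis using valid_right assms by blast
next
  case down then show ?thesis using valid_down assms by blast
next
  case finish then show ?thesis using valid_finish assms by blast
qed

lemma step_exists:
  assumes "is_partition \<mu>" "valid n \<mu> s" "\<And>\<nu> t. s \<noteq> Done \<nu> t"
  shows "\<exists>s'. step \<mu> s s'"
proof (cases s)
  case (Ins r c t)
  show ?thesis
  proof (cases "\<forall>j<\<mu> r. t (r, j) \<le> c")
    case True then show ?thesis using step.append Ins by blast
  next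
    case False
    define k where "k = (LEAST j. j < \<mu> r \<and> c < t (r, j))"
    have k: "k < \<mu> r" "c < t (r, k)"
      using LeastI_ex[of "\<lambda>j. j < \<mu> r \<and> c < t (r, j)"] False by (auto simp: k_def not_le)
    have l: "\<forall>j<k. t (r, j) \<le> c"
      using k not_less_Least[of _ "\<lambda>j. j < \<mu> r \<and> c < t (r, j)"] by (metis k_def leI less_trans)
    show ?thesis
    proof (cases "t (r, k) = Bar (Suc r)")
      case False then show ?thesis using step.bump k l Ins by blast
    next
      case True
      \<comment> \<open>Only \<open>Letter (Suc r)\<close> fits between the row bound and
        \<open>Bar (Suc r)\<close>. The letters left of \<open>k\<close> are squeezed between the
        row bound and \<open>c\<close>, hence equal to it.\<close>
      have c: "c = Letter (Suc r)"
        using Letter_less_Suc[of c r] assms(2) k True Ins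
          less_trans[OF _ Letter_ge_simps(3), of c r] by auto
      have f: "filling n {} \<mu> t" using assms Ins by simp
      have "\<forall>j<k. t (r, j) = Letter (Suc r)"
        using filling_ge[OF f, of _ r] l k c by (auto intro!: antisym)
      then show ?thesis using step.cancel k True c Ins by blast
    qed
  qed
next
  case (Slide i j t)
  consider "Suc j < \<mu> i \<and> (j < \<mu> (Suc i) \<longrightarrow> t (i, Suc j) < t (Suc i, j))"
    | "j < \<mu> (Suc i) \<and> (Suc j < \<mu> i \<longrightarrow> t (Suc i, j) \<le> t (i, Suc j))"
    | "\<mu> i \<le> Suc j \<and> \<mu> (Suc i) \<le> j" by force
  then show ?thesis
  proof cases
    case 3
    then have "Suc j = \<mu> i" using assms Slide by auto
    then show ?thesis using step.finish 3 Slide by blast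
  qed (use step.right step.down Slide in blast)+
qed (use assms in auto)

lemma finite_support_bound:
  assumes "is_partition \<mu>"
  obtains B where "\<And>i. B \<le> i \<Longrightarrow> \<mu> i = 0"
proof -
  have "finite {i. \<mu> i \<noteq> 0}" using assms by (simp add: is_partition_def)
  then obtain B where "{i. \<mu> i \<noteq> 0} \<subseteq> {..<B}" by (auto simp: finite_nat_iff_bounded)
  then show ?thesis using that by (metis (mono_tags) lessThan_iff leD mem_Collect_eq subsetD)
qed

section \<open>Backward steps: undoing each rule\<close>

lemma valid_unbump:
  assumes p: "is_partition \<mu>" and v: "valid n \<mu> (Ins (Suc r) b t')"
  shows "\<exists>s. valid n \<mu> s \<and> step \<mu> s (Ins (Suc r) b t')"
proof -
  have f: "filling n {} \<mu> t'" and b: "b \<in> alphabet n" "Letter (Suc (Suc r)) \<le> b" using v by auto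
  obtain l where l: "l < \<mu> r" "t' (r, l) < b" "l < \<mu> (Suc r) \<longrightarrow> b < t' (Suc r, l)"
    using v by auto
  \<comment> \<open>The letter \<open>b\<close> returns to the rightmost box holding a smaller
    letter. Everything to its right is at least \<open>b\<close>; everything under it exceeds
    \<open>b\<close>, because this column is not left of the witness \<open>l\<close>.\<close>
  let ?S = "{k. k < \<mu> r \<and> t' (r, k) < b}"
  define k where "k = Max ?S"
  have fin: "finite ?S" by simp
  have "k \<in> ?S" unfolding k_def by (rule Max_in) (use l in auto)
  then have k: "k < \<mu> r" "t' (r, k) < b" by auto
  have lk: "l \<le> k" unfolding k_def by (rule Max_ge) (use l in auto)
  have ka: "b \<le> t' (r, j)" if "k < j" "j < \<mu> r" for j
    using Max_ge[OF fin, of j] that unfolding k_def[symmetric] by force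
  have below: "b < t' (i, k)" if "r < i" "k < \<mu> i" for i
  proof -
    have "k < \<mu> (Suc r)" using partition_mono[OF p, of "Suc r" i] that by simp
    then have "b < t' (Suc r, k)" using l lk filling_row_le[OF f lk, of "Suc r"] by auto
    then show ?thesis using filling_col[OF f, of "Suc r" i k] that by (cases "i = Suc r") auto
  qed
  let ?c = "t' (r, k)" and ?t = "t'((r, k) := b)"
  have f': "filling n {} \<mu> ?t"
  proof (rule fillingI)
    fix i j j' assume "j < j'" "j' < \<mu> i"
    then show "?t (i, j) \<le> ?t (i, j')"
      using filling_row[OF f, of j j' i] k ka by auto
  next
    fix i i' j assume "i < i'" "j < \<mu> i'"
    then show "?t (i, j) < ?t (i', j)"
      using filling_col[OF f, of i i' j] k below[of i'] by auto
  next
    fix i j assume "j < \<mu> i"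
    then show "?t (i, j) \<in> alphabet n" "Letter (Suc i) \<le> ?t (i, j)"
      using filling_alphabet[OF f, of j i] filling_ge[OF f, of j i] b Letter_ge_simps(4)[of r] by auto
  qed (use f k in \<open>auto intro: filling_outside\<close>)
  have "\<exists>l<\<mu> i. ?t (i, l) < ?c \<and> (l < \<mu> r \<longrightarrow> ?c < ?t (r, l))" if "r = Suc i" for i
    using k filling_col[OF f, of i r k] partition_mono[OF p, of i r] that by (intro exI[of _ k]) auto
  then have "valid n \<mu> (Ins r ?c ?t)"
    using f' f k by (auto intro: filling_alphabet filling_ge)
  moreover have "step \<mu> (Ins r ?c ?t) (Ins (Suc r) (?t (r, k)) (?t((r, k) := ?c)))"
    using k b filling_row[OF f, of _ k r] Letter_ge_simps(3)[of r] by (intro step.bump) auto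
  ultimately have "valid n \<mu> (Ins r ?c ?t) \<and> step \<mu> (Ins r ?c ?t) (Ins (Suc r) b t')"
    by (simp del: valid.simps)
  then show ?thesis by blast
qed

text \<open>The row starts with the hole and a possibly empty block of
  \<open>Letter (Suc r)\<close>. Filling the hole with this letter and putting
  \<open>Bar (Suc r)\<close> at the end of the block restores the row. Rows below contain only
  larger letters, the hypothesis on the letter above the hole controls the columns, and
  \<open>r < n\<close> puts both letters into the alphabet.\<close>

lemma valid_uncancel:
  assumes p: "is_partition \<mu>" and v: "valid n \<mu> (Slide r 0 t')" and n: "r < n"
    and u: "\<forall>i. r = Suc i \<longrightarrow> t' (i, 0) < Letter (Suc r)"
  shows "\<exists>s. valid n \<mu> s \<and> step \<mu> s (Slide r 0 t')"
proof -
  let ?L = "Letter (Suc r)" and ?B = "Bar (Suc r)"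
  have f: "filling n {(r, 0)} \<mu> t'" and r: "0 < \<mu> r" using v by auto
  have t0: "t' (r, 0) = Letter 0" using filling_outside[OF f] by simp
  \<comment> \<open>The placeholder in the hole is below every letter, so column 0 belongs to the
    set; if the block is empty, \<open>k = 0\<close>.\<close>
  let ?S = "{k. k < \<mu> r \<and> t' (r, k) \<le> ?L}"
  define k where "k = Max ?S"
  have fin: "finite ?S" by simp
  have "k \<in> ?S" unfolding k_def by (rule Max_in) (use t0 r Letter_ge_simps(5) in auto)
  then have k: "k < \<mu> r" "t' (r, k) \<le> ?L" by auto
  have ka: "?L < t' (r, j)" if "k < j" "j < \<mu> r" for j
    using Max_ge[OF fin, of j] that unfolding k_def[symmetric] by force
  have kb: "t' (r, j) = ?L" if "0 < j" "j \<le> k" for j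
    using filling_ge[OF f, of j r] filling_row[OF f, of j k r] k that
    by (cases "j = k") auto
  have ka': "?B \<le> t' (r, j)" if "k < j" "j < \<mu> r" for j
    using ka[OF that] by (cases "t' (r, j)") (auto simp: less_eq_letter_def less_letter_def)
  have above: "t' (i, j) < ?L" if "j \<le> k" and ir: "i < r" for i j
  proof (cases "j = 0")
    case True
    obtain r' where "r = Suc r'" using ir by (cases r) auto
    then show ?thesis using that u True filling_col[OF f, of i r' j] partition_mono[OF p, of r' r] r
      by (cases "i = r'") auto
  next
    case False
    then show ?thesis using filling_col[OF f, of i r j] kb[of j] that k by auto
  qed
  have below: "?B < t' (i, j)" if "r < i" "j < \<mu> i" for i j
    using filling_ge[OF f, of j i] that by (cases "t' (i, j)") (auto simp: less_eq_letter_def less_letter_def)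
  have al: "?L \<in> alphabet n" "?B \<in> alphabet n" using n by (auto simp: alphabet_def)
  let ?t = "t'((r, 0) := ?L, (r, k) := ?B)"
  have tr: "?t (r, j) = (if j < k then ?L else if j = k then ?B else t' (r, j))" for j
    using kb[of j] by (cases "j = 0") auto
  have to: "?t (i, j) = t' (i, j)" if "i \<noteq> r" for i j using that by simp
  have f': "filling n {} \<mu> ?t"
  proof (rule fillingI)
    fix i j j' assume "j < j'" "j' < \<mu> i"
    then show "?t (i, j) \<le> ?t (i, j')"
      using filling_row[OF f, of j j' i] ka'[of j'] less_imp_le[OF ka[of j']] Letter_ge_simps(1)[of r]
      by (cases "i = r") (auto simp: tr to simp del: fun_upd_apply)
  next
    fix i i' j assume a: "i < i'" "j < \<mu> i'"
    then consider "i = r" | "i' = r" | "i \<noteq> r" "i' \<noteq> r" by auto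
    then show "?t (i, j) < ?t (i', j)"
    proof cases
      case 1
      then have "?t (i, j) < t' (i', j)"
        using below[of i' j] a filling_col[OF f, of i i' j] less_trans[OF Letter_ge_simps(2)[of r] below[of i' j]]
        by (auto simp: tr simp del: fun_upd_apply)
      then show ?thesis using 1 a by auto
    next
      case 2
      then have "t' (i, j) < ?t (i', j)"
        using above[of j i] a filling_col[OF f, of i i' j] less_trans[OF above[of j i] Letter_ge_simps(2)[of r]]
        by (auto simp: tr simp del: fun_upd_apply)
      then show ?thesis using 2 a by auto
    next
      case 3
      then show ?thesis using filling_col[OF f, of i i' j] a by auto
    qed
  next
    fix i j assume "j < \<mu> i"
    then show "?t (i, j) \<in> alphabet n" "Letter (Suc i) \<le> ?t (i, j)"
      using filling_alphabet[OF f, of j i] filling_ge[OF f, of j i] al Letter_ge_simps(1)[of r] by auto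
  next
    fix i j assume "\<mu> i \<le> j \<or> (i, j) \<in> {}"
    then show "?t (i, j) = Letter 0"
      using filling_outside[OF f, of i j] k by auto
  qed
  have "\<exists>l<\<mu> i. ?t (i, l) < ?L \<and> (l < \<mu> r \<longrightarrow> ?L < ?t (r, l))" if "r = Suc i" for i
    using k above[of k i] Letter_ge_simps(2)[of r] partition_mono[OF p, of i r] that
    by (intro exI[of _ k]) auto
  then have "valid n \<mu> (Ins r ?L ?t)" using f' al by auto
  moreover have "step \<mu> (Ins r ?L ?t) (Slide r 0 (?t((r, k) := ?L, (r, 0) := Letter 0)))"
    using k by (intro step.cancel) (auto simp: tr simp del: fun_upd_apply)
  moreover have "?t((r, k) := ?L, (r, 0) := Letter 0) = t'"
    using t0 kb[of k] by (intro ext) (auto simp: fun_upd_def)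
  ultimately show ?thesis by metis
qed

text \<open>The left letter goes back when it exceeds the one above the hole. Below, strictness
  follows from \<open>t' (i, j) < t' (i1, j) \<le> t' (i1, Suc j)\<close>, and the first inequality
  also shows that the sliding rule chose this direction.\<close>

lemma valid_unright:
  assumes p: "is_partition \<mu>" and v: "valid n \<mu> (Slide i (Suc j) t')"
    and u: "\<forall>i'. i = Suc i' \<longrightarrow> t' (i', Suc j) < t' (i, j)"
  shows "\<exists>s. valid n \<mu> s \<and> step \<mu> s (Slide i (Suc j) t')"
proof -
  let ?t = "t'((i, Suc j) := t' (i, j), (i, j) := Letter 0)"
  have f: "filling n {(i, Suc j)} \<mu> t'" and s: "Suc j < \<mu> i" using v by auto
  have above: "t' (i1, Suc j) < t' (i, j)" if i1: "i1 < i" for i1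
  proof -
    obtain i' where i': "i = Suc i'" using i1 by (cases i) auto
    have "Suc j < \<mu> i'" using partition_mono[OF p, of i' i] i' s by simp
    then show ?thesis
      using filling_col[OF f, of i1 i' "Suc j"] that i' u by (cases "i1 = i'") auto
  qed
  have below: "t' (i, j) < t' (i1, j)" if "i < i1" "j < \<mu> i1" for i1
    using filling_col[OF f, of i i1 j] that by auto
  have below': "t' (i, j) < t' (i1, Suc j)" if "i < i1" "Suc j < \<mu> i1" for i1
    using filling_col[OF f, of i i1 j] filling_row[OF f, of j "Suc j" i1] that by auto
  have "filling n {(i, j)} \<mu> ?t"
  proof (rule fillingI)
    fix i1 j1 j2 assume a: "j1 < j2" "j2 < \<mu> i1" "(i1, j1) \<notin> {(i, j)}" "(i1, j2) \<notin> {(i, j)}"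
    then show "?t (i1, j1) \<le> ?t (i1, j2)"
      using filling_row[OF f, of j1 j2 i1] filling_row[OF f, of j j2 i1] filling_row[OF f, of j1 j i] s
      by auto
  next
    fix i1 i2 j1 assume "i1 < i2" "j1 < \<mu> i2" "(i1, j1) \<notin> {(i, j)}" "(i2, j1) \<notin> {(i, j)}"
    then show "?t (i1, j1) < ?t (i2, j1)"
      using filling_col[OF f, of i1 i2 j1] above[of i1] below'[of i2] by auto
  next
    fix i1 j1 assume "\<mu> i1 \<le> j1 \<or> (i1, j1) \<in> {(i, j)}"
    then show "?t (i1, j1) = Letter 0"
      using filling_outside[OF f, of i1 j1] s by auto
  next
    fix i1 j1 assume "j1 < \<mu> i1" "(i1, j1) \<notin> {(i, j)}"
    then show "?t (i1, j1) \<in> alphabet n" "Letter (Suc i1) \<le> ?t (i1, j1)"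
      using filling_alphabet[OF f, of j1 i1] filling_ge[OF f, of j1 i1]
        filling_alphabet[OF f, of j i] filling_ge[OF f, of j i] s by auto
  qed
  then have "valid n \<mu> (Slide i j ?t)" using s by simp
  moreover have "step \<mu> (Slide i j ?t) (Slide i (Suc j) (?t((i, j) := ?t (i, Suc j), (i, Suc j) := Letter 0)))"
    using s below[of "Suc i"] by (intro step.right) auto
  moreover have "?t((i, j) := ?t (i, Suc j), (i, Suc j) := Letter 0) = t'"
    using filling_outside[OF f, of i "Suc j"] by (intro ext) auto
  ultimately show ?thesis by metis
qed

text \<open>The upper letter drops back when the row of the hole admits it and the left neighbour
  does not exceed it. The sliding rule then chose this direction, ties included, because row
  \<open>i\<close> increases weakly.\<close>

lemma valid_undown:
  assumes p: "is_partition \<mu>" and v: "valid n \<mu> (Slide (Suc i) j t')"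
    and u: "Letter (Suc (Suc i)) \<le> t' (i, j)" "\<forall>j1. j = Suc j1 \<longrightarrow> t' (Suc i, j1) \<le> t' (i, j)"
  shows "\<exists>s. valid n \<mu> s \<and> step \<mu> s (Slide (Suc i) j t')"
proof -
  let ?t = "t'((Suc i, j) := t' (i, j), (i, j) := Letter 0)"
  have f: "filling n {(Suc i, j)} \<mu> t'" and s: "j < \<mu> (Suc i)" using v by auto
  have s': "j < \<mu> i" using s partition_mono[OF p, of i "Suc i"] by simp
  have left: "t' (Suc i, j1) \<le> t' (i, j)" if j1: "j1 < j" for j1
  proof -
    obtain j' where "j = Suc j'" using j1 by (cases j) auto
    then show ?thesis using u(2) filling_row[OF f, of j1 j' "Suc i"] that s by (cases "j1 = j'") auto
  qed
  have rght: "t' (i, j) \<le> t' (Suc i, j1)" if "j < j1" "j1 < \<mu> (Suc i)" for j1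
    using filling_row[OF f, of j j1 i] filling_col[OF f, of i "Suc i" j1] that
      partition_mono[OF p, of i "Suc i"] by auto
  have "filling n {(i, j)} \<mu> ?t"
  proof (rule fillingI)
    fix i1 j1 j2 assume "j1 < j2" "j2 < \<mu> i1" "(i1, j1) \<notin> {(i, j)}" "(i1, j2) \<notin> {(i, j)}"
    then show "?t (i1, j1) \<le> ?t (i1, j2)"
      using filling_row[OF f, of j1 j2 i1] left[of j1] rght[of j2] s by auto
  next
    fix i1 i2 j1 assume "i1 < i2" "j1 < \<mu> i2" "(i1, j1) \<notin> {(i, j)}" "(i2, j1) \<notin> {(i, j)}"
    then show "?t (i1, j1) < ?t (i2, j1)"
      using filling_col[OF f, of i1 i2 j1] filling_col[OF f, of i1 i j1]
         filling_col[OF f, of i i2 j1] s' by auto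
  next
    fix i1 j1 assume "\<mu> i1 \<le> j1 \<or> (i1, j1) \<in> {(i, j)}"
    then show "?t (i1, j1) = Letter 0"
      using filling_outside[OF f, of i1 j1] s by auto
  next
    fix i1 j1 assume "j1 < \<mu> i1" "(i1, j1) \<notin> {(i, j)}"
    then show "?t (i1, j1) \<in> alphabet n" "Letter (Suc i1) \<le> ?t (i1, j1)"
      using filling_alphabet[OF f, of j1 i1] filling_ge[OF f, of j1 i1]
        filling_alphabet[OF f, of j i] u s' by auto
  qed
  then have "valid n \<mu> (Slide i j ?t)" using s' by simp
  moreover have "step \<mu> (Slide i j ?t) (Slide (Suc i) j (?t((i, j) := ?t (Suc i, j), (Suc i, j) := Letter 0)))"
    using s filling_row[OF f, of j "Suc j" i] by (intro step.down) auto
  moreover have "?t((i, j) := ?t (Suc i, j), (Suc i, j) := Letter 0) = t'"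
    using filling_outside[OF f, of "Suc i" j] by (intro ext) auto
  ultimately show ?thesis by metis
qed

lemma valid_unappend:
  assumes p: "is_partition \<mu>" and v: "valid n \<mu> (Done \<nu> t')" and \<nu>: "\<nu> = \<mu>(r := \<mu> r + 1)"
  shows "\<exists>s. valid n \<mu> s \<and> step \<mu> s (Done \<nu> t')"
proof -
  have f: "filling n {} \<nu> t'" and q: "is_partition \<nu>" using v by auto
  let ?t = "t'((r, \<mu> r) := Letter 0)" and ?c = "t' (r, \<mu> r)"
  have c: "?c \<in> alphabet n" "Letter (Suc r) \<le> ?c"
    using filling_alphabet[OF f, of "\<mu> r" r] filling_ge[OF f, of "\<mu> r" r] \<nu> by auto
  have f': "filling n {} \<mu> ?t"
  proof (rule fillingI)
    fix i j j' assume "j < j'" "j' < \<mu> i"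
    then show "?t (i, j) \<le> ?t (i, j')"
      using filling_row[OF f, of j j' i] \<nu> by (cases "i = r") auto
  next
    fix i i' j assume a: "i < i'" "j < \<mu> i'"
    then have "(i, j) \<noteq> (r, \<mu> r)" "(i', j) \<noteq> (r, \<mu> r)"
      using partition_mono[OF p, of i i'] by auto
    then show "?t (i, j) < ?t (i', j)"
      using filling_col[OF f, of i i' j] a \<nu> by (cases "i' = r") auto
  next
    fix i j assume "\<mu> i \<le> j \<or> (i, j) \<in> {}"
    then show "?t (i, j) = Letter 0"
      using filling_outside[OF f, of i j] \<nu> by (cases "i = r") auto
  next
    fix i j assume "j < \<mu> i"
    then show "?t (i, j) \<in> alphabet n" "Letter (Suc i) \<le> ?t (i, j)"
      using filling_alphabet[OF f, of j i] filling_ge[OF f, of j i] \<nu> by (cases "i = r"; auto)+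
  qed
  have "\<exists>l<\<mu> i. ?t (i, l) < ?c \<and> (l < \<mu> r \<longrightarrow> ?c < ?t (r, l))" if "r = Suc i" for i
    using filling_col[OF f, of i r "\<mu> r"] partition_mono[OF q, of i r] that \<nu>
    by (intro exI[of _ "\<mu> r"]) auto
  then have "valid n \<mu> (Ins r ?c ?t)" using f' c by auto
  moreover have "step \<mu> (Ins r ?c ?t) (Done (\<mu>(r := Suc (\<mu> r))) (?t((r, \<mu> r) := ?c)))"
    using filling_row[OF f, of _ "\<mu> r" r] \<nu> by (intro step.append) auto
  ultimately have "valid n \<mu> (Ins r ?c ?t) \<and> step \<mu> (Ins r ?c ?t) (Done \<nu> t')"
    using \<nu> by (simp del: valid.simps)
  then show ?thesis by blast
qed

lemma valid_unfinish:
  assumes p: "is_partition \<mu>" and v: "valid n \<mu> (Done \<nu> t')"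
    and \<nu>: "\<nu> = \<mu>(i := \<mu> i - 1)" "0 < \<mu> i"
  shows "\<exists>s. valid n \<mu> s \<and> step \<mu> s (Done \<nu> t')"
proof -
  have f: "filling n {} \<nu> t'" and q: "is_partition \<nu>" using v by auto
  obtain j where j: "\<mu> i = Suc j" using \<nu> by (cases "\<mu> i") auto
  have "filling n {(i, j)} \<mu> t'"
  proof (rule fillingI)
    fix i1 j1 j2 assume "j1 < j2" "j2 < \<mu> i1" "(i1, j1) \<notin> {(i, j)}" "(i1, j2) \<notin> {(i, j)}"
    then show "t' (i1, j1) \<le> t' (i1, j2)"
      using filling_row[OF f, of j1 j2 i1] \<nu> j by (cases "i1 = i") auto
  next
    fix i1 i2 j1 assume "i1 < i2" "j1 < \<mu> i2" "(i1, j1) \<notin> {(i, j)}" "(i2, j1) \<notin> {(i, j)}"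
    then show "t' (i1, j1) < t' (i2, j1)"
      using filling_col[OF f, of i1 i2 j1] \<nu> j by (cases "i2 = i") auto
  next
    fix i1 j1 assume "\<mu> i1 \<le> j1 \<or> (i1, j1) \<in> {(i, j)}"
    then show "t' (i1, j1) = Letter 0"
      using filling_outside[OF f, of i1 j1] \<nu> j by (cases "i1 = i") auto
  next
    fix i1 j1 assume "j1 < \<mu> i1" "(i1, j1) \<notin> {(i, j)}"
    then show "t' (i1, j1) \<in> alphabet n" "Letter (Suc i1) \<le> t' (i1, j1)"
      using filling_alphabet[OF f, of j1 i1] filling_ge[OF f, of j1 i1] \<nu> j
      by (cases "i1 = i"; auto)+
  qed
  then have "valid n \<mu> (Slide i j t')" using j by simp
  moreover have "step \<mu> (Slide i j t') (Done (\<mu>(i := j)) t')"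
    using j partition_mono[OF q, of i "Suc i"] \<nu> by (intro step.finish) auto
  ultimately have "valid n \<mu> (Slide i j t') \<and> step \<mu> (Slide i j t') (Done \<nu> t')"
    using \<nu> j by (simp del: valid.simps)
  then show ?thesis by blast
qed

lemma step_backward:
  assumes p: "is_partition \<mu>" and n: "\<And>i. 0 < \<mu> i \<Longrightarrow> i < n"
    and v: "valid n \<mu> s'" and nI: "\<And>c t. s' \<noteq> Ins 0 c t"
  shows "\<exists>s. valid n \<mu> s \<and> step \<mu> s s'"
proof (cases s')
  case (Ins r b t')
  with nI obtain r' where "r = Suc r'" by (cases r) auto
  then show ?thesis using valid_unbump[OF p] v Ins by blast
next
  case (Slide i j t')
  have v: "valid n \<mu> (Slide i j t')" using v Slide by simp
  then have ij: "j < \<mu> i" "filling n {(i, j)} \<mu> t'" by auto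
  consider
      "j = 0" "\<forall>i'. i = Suc i' \<longrightarrow> t' (i', 0) < Letter (Suc i)"
    | j' where "j = Suc j'" "\<forall>i'. i = Suc i' \<longrightarrow> t' (i', j) < t' (i, j')"
    | i' where "i = Suc i'" "j = 0" "Letter (Suc i) \<le> t' (i', 0)"
    | i' j' where "i = Suc i'" "j = Suc j'" "t' (i, j') \<le> t' (i', j)"
  proof (cases i)
    case 0
    then show thesis by (cases j) (auto intro: that(1,2))
  next
    case (Suc i')
    show thesis
    proof (cases j)
      case 0
      with Suc show thesis
        by (cases "t' (i', 0) < Letter (Suc i)") (auto intro: that(1) that(3)[of i'] simp: not_less)
    next
      case j: (Suc j')
      with Suc show thesis
        by (cases "t' (i', j) < t' (i, j')") (auto intro: that(2) that(4)[of i' j'] simp: not_less)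
    qed
  qed
  then show ?thesis
  proof cases
    case 1 then show ?thesis using valid_uncancel[OF p, of n i t'] v ij n Slide by auto
  next
    case 2 then show ?thesis using valid_unright[OF p] v Slide by blast
  next
    case 3 then show ?thesis using valid_undown[OF p] v Slide by blast
  next
    case 4
    \<comment> \<open>Outside the first column the row bound need not be tested: the left neighbour
      satisfies it and is at most the upper letter.\<close>
    moreover have "Letter (Suc i) \<le> t' (i, j')" using filling_ge[OF ij(2), of j' i] ij 4 by auto
    ultimately show ?thesis using valid_undown[OF p, of n i' j t'] v Slide by auto
  qed
next
  case (Done \<nu> t')
  then have v: "valid n \<mu> (Done \<nu> t')" using v by simp
  then have "one_box_step \<mu> \<nu>" by simp
  then show ?thesis using valid_unappend[OF p v] valid_unfinish[OF p v] Done
    unfolding one_box_step_def by blast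
qed

subsection \<open>Uniqueness of runs\<close>

text \<open>Everything about a cancellation can be read off its image: the columns up to
  \<open>k\<close> are those with a letter at most \<open>Letter (Suc r)\<close>, the hole being
  counted through its placeholder. The first conclusion separates a cancellation from a slide coming
  from above.\<close>

lemma cancel_image:
  assumes p: "is_partition \<mu>" and v: "valid n \<mu> (Ins r (Letter (Suc r)) t)"
    and k: "k < \<mu> r" "\<forall>j<k. t (r, j) = Letter (Suc r)" "t (r, k) = Bar (Suc r)"
    and t': "t' = t((r, k) := Letter (Suc r), (r, 0) := Letter 0)"
  shows "i < r \<Longrightarrow> t' (i, 0) < Letter (Suc r)"
    and "{j. j < \<mu> r \<and> t' (r, j) \<le> Letter (Suc r)} = {..k}"
    and "t = t'((r, 0) := Letter (Suc r), (r, k) := Bar (Suc r))"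
proof -
  have f: "filling n {} \<mu> t" using v by auto
  show "t' (i, 0) < Letter (Suc r)" if "i < r"
    using insertion_above[OF v p, of k i] k that t' filling_row_le[OF f, of 0 k i] by auto
  have "Letter (Suc r) < t (r, j)" if "k < j" "j < \<mu> r" for j
    using filling_row[OF f that] k Letter_ge_simps(2)[of r] by auto
  then show "{j. j < \<mu> r \<and> t' (r, j) \<le> Letter (Suc r)} = {..k}"
    using k t' Letter_ge_simps(5) by (force simp: not_less[symmetric])
  show "t = t'((r, 0) := Letter (Suc r), (r, k) := Bar (Suc r))"
    unfolding t' using k by (intro ext) auto
qed

lemma bump_image:
  assumes v: "valid n \<mu> (Ins r c t)" and k: "k < \<mu> r" "\<forall>j<k. t (r, j) \<le> c" "c < t (r, k)"
    and t': "t' = t((r, k) := c)" and b: "b = t (r, k)"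
  shows "{j. j < \<mu> r \<and> t' (r, j) < b} = {..k}"
    and "c = t' (r, k)" "t = t'((r, k) := b)"
proof -
  have f: "filling n {} \<mu> t" using v by auto
  show "{j. j < \<mu> r \<and> t' (r, j) < b} = {..k}"
  proof (intro set_eqI iffI)
    fix j assume "j \<in> {j. j < \<mu> r \<and> t' (r, j) < b}"
    then show "j \<in> {..k}"
      using filling_row[OF f, of k j r] k b t' by (cases "k < j") auto
  next
    fix j assume "j \<in> {..k}"
    then show "j \<in> {j. j < \<mu> r \<and> t' (r, j) < b}"
      using k b t' le_less_trans[of "t (r, j)" c "t (r, k)"] by (cases "j = k") auto
  qed
qed (use t' b in auto)

lemma not_step_Ins_0: "\<not> step \<mu> s (Ins 0 c t)"
  by (auto elim: step.cases)

text \<open>When both steps use the same rule, the source is recovered from the image. Rules whose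
  images are of the same kind are separated by whether the shape grew or shrank, or by contradictory
  inequalities around the hole.\<close>

lemma step_left_unique:
  assumes p: "is_partition \<mu>" and v: "valid n \<mu> s1" "valid n \<mu> s2"
    and s: "step \<mu> s1 s'" "step \<mu> s2 s'"
  shows "s1 = s2"
  using s(1)
proof cases
  case (bump k1 r t1 c1)
  from s(2)[unfolded bump(2)] show ?thesis
  proof cases
    case (bump k2 t2 c2)
    have e: "t1((r, k1) := c1) = t2((r, k2) := c2)" "t1 (r, k1) = t2 (r, k2)" by fact+
    note 1 = bump_image[of n \<mu> r c1 t1 k1, OF v(1)[unfolded \<open>s1 = _\<close>] \<open>k1 < _\<close> \<open>\<forall>j<k1. _\<close> \<open>c1 < _\<close> refl refl]
    note 2 = bump_image[of n \<mu> r c2 t2 k2, OF v(2)[unfolded \<open>s2 = _\<close>] \<open>k2 < _\<close> \<open>\<forall>j<k2. _\<close> \<open>c2 < _\<close> e]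
    have "{..k1} = {..k2}" using 1(1) 2(1) by (rule trans[OF sym])
    then have k: "k2 = k1" by simp
    have "c1 = c2" using 1(2) 2(2)[unfolded k] by (rule trans[OF _ sym])
    moreover have "t1 = t2" using 1(3) 2(3)[unfolded k] by (rule trans[OF _ sym])
    ultimately show ?thesis using \<open>s1 = _\<close> \<open>s2 = _\<close> by simp
  qed
next
  case (append r t1 c1)
  from s(2)[unfolded append(2)] show ?thesis
  proof cases
    case (append r2 t2 c2)
    have f1: "filling n {} \<mu> t1" using v(1) \<open>s1 = _\<close> by simp
    have f2: "filling n {} \<mu> t2" using v(2) append by simp
    have e: "\<mu>(r := Suc (\<mu> r)) = \<mu>(r2 := Suc (\<mu> r2))" "t1((r, \<mu> r) := c1) = t2((r2, \<mu> r2) := c2)"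
      using append by simp_all
    have r: "r = r2" using fun_cong[OF e(1), of r] by (auto split: if_splits)
    have "c1 = c2" using fun_cong[OF e(2), of "(r, \<mu> r)"] r by simp
    moreover have "t1 x = t2 x" for x
      using fun_cong[OF e(2), of x] r filling_outside[OF f1, of r "\<mu> r"] filling_outside[OF f2, of r "\<mu> r"]
      by (cases "x = (r, \<mu> r)") auto
    ultimately show ?thesis using r append \<open>s1 = _\<close> by auto
  next
    case (finish j i)
    then have "\<mu>(r := Suc (\<mu> r)) = \<mu>(i := j)" by simp
    from fun_cong[OF this, of r] show ?thesis using \<open>Suc j = \<mu> i\<close> by (auto split: if_splits)
  qed
next
  case (cancel k1 r t1)
  note c1 = cancel_image[OF p v(1)[unfolded cancel(1)] cancel(3-5) refl]
  from s(2)[unfolded cancel(2)] show ?thesis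
  proof cases
    case (cancel k2 t2)
    have e: "t1((r, k1) := Letter (Suc r), (r, 0) := Letter 0) = t2((r, k2) := Letter (Suc r), (r, 0) := Letter 0)"
      by fact
    note c2 = cancel_image[OF p v(2)[unfolded \<open>s2 = _\<close>] \<open>k2 < _\<close> \<open>\<forall>j<k2. _\<close> \<open>t2 (r, k2) = _\<close> e]
    have "{..k1} = {..k2}" using c1(2) c2(2) by (rule trans[OF sym])
    then have k: "k2 = k1" by simp
    have "t1 = t2" using c1(3) c2(3)[unfolded k] by (rule trans[OF _ sym])
    then show ?thesis using \<open>s1 = _\<close> \<open>s2 = _\<close> by simp
  next
    \<comment> \<open>The letter above the hole would have risen from row \<open>r\<close> and
      respect its bound, whereas a cancellation in row \<open>r\<close> leaves only smaller letters
      above the first column.\<close>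
    case (down i t2)
    have f: "filling n {(i, 0)} \<mu> t2" using v(2) \<open>s2 = _\<close> by simp
    have "Letter (Suc r) \<le> t2 (r, 0)" using filling_ge[OF f, of 0 r] down by auto
    moreover have e: "t1((r, k1) := Letter (Suc r), (r, 0) := Letter 0) = t2((i, 0) := t2 (Suc i, 0), (Suc i, 0) := Letter 0)"
      "r = Suc i" using down by simp_all
    have "t2 (r, 0) < Letter (Suc r)"
      using c1(1)[of i] unfolding e(1) unfolding e(2) by simp
    ultimately show ?thesis by simp
  qed
next
  case (right j i t1)
  from s(2)[unfolded right(2)] show ?thesis
  proof cases
    case (right t2)
    have f1: "filling n {(i, j)} \<mu> t1" using v(1) \<open>s1 = _\<close> by simp
    have f2: "filling n {(i, j)} \<mu> t2" using v(2) \<open>s2 = _\<close> by simp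
    have e: "t1((i, j) := t1 (i, Suc j), (i, Suc j) := Letter 0) = t2((i, j) := t2 (i, Suc j), (i, Suc j) := Letter 0)"
      using right by simp
    \<comment> \<open>At the old hole the image says nothing about the source; both sources hold the
      placeholder there.\<close>
    have "t1 x = t2 x" for x
      using fun_cong[OF e, of x] fun_cong[OF e, of "(i, j)"] filling_outside[OF f1, of i j] filling_outside[OF f2, of i j]
      by (cases "x = (i, j)"; cases "x = (i, Suc j)") auto
    then show ?thesis using \<open>s1 = _\<close> \<open>s2 = _\<close> by auto
  next
    \<comment> \<open>A move to the right leaves the upper neighbour of the hole smaller than the
      left one; a move down leaves it at least as large.\<close>
    case (down i' t2)
    have f1: "filling n {(i, j)} \<mu> t1" using v(1) \<open>s1 = _\<close> by simp
    have f2: "filling n {(i', Suc j)} \<mu> t2" using v(2) \<open>s2 = _\<close> by simp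
    have e: "t1((i, j) := t1 (i, Suc j), (i, Suc j) := Letter 0) =
        t2((i', Suc j) := t2 (i, Suc j), (i, Suc j) := Letter 0)"
      using down by simp
    have "t1 (i, Suc j) = t2 (i, j)" "t1 (i', Suc j) = t2 (i, Suc j)"
      using fun_cong[OF e, of "(i, j)"] fun_cong[OF e, of "(i', Suc j)"] down by auto
    moreover have "t1 (i', Suc j) < t1 (i, Suc j)"
      using filling_col[OF f1, of i' i "Suc j"] down \<open>Suc j < \<mu> i\<close> by auto
    moreover have "t2 (i, j) \<le> t2 (i, Suc j)"
      using filling_row[OF f2, of j "Suc j" i] down \<open>Suc j < \<mu> i\<close> by auto
    ultimately show ?thesis by simp
  qed
next
  case (down j i t1)
  from s(2)[unfolded down(2)] show ?thesis
  proof cases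
    case (cancel k t2)
    note c1 = cancel_image[OF p v(2)[unfolded \<open>s2 = _\<close>] cancel(4-6) refl]
    have f: "filling n {(i, 0)} \<mu> t1" using v(1) \<open>s1 = _\<close> cancel by simp
    have "Letter (Suc (Suc i)) \<le> t1 (Suc i, 0)" using filling_ge[OF f, of 0 "Suc i"] cancel down by auto
    moreover have e: "t2((Suc i, k) := Letter (Suc (Suc i)), (Suc i, 0) := Letter 0) =
        t1((i, 0) := t1 (Suc i, 0), (Suc i, 0) := Letter 0)" using cancel by simp
    have "t1 (Suc i, 0) < Letter (Suc (Suc i))"
      using c1(1)[of i] unfolding e by simp
    ultimately show ?thesis by simp
  next
    case (right j' t2)
    have f1: "filling n {(Suc i, j')} \<mu> t2" using v(2) \<open>s2 = _\<close> by simp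
    have f2: "filling n {(i, Suc j')} \<mu> t1" using v(1) \<open>s1 = _\<close> right by simp
    have e: "t2((Suc i, j') := t2 (Suc i, Suc j'), (Suc i, Suc j') := Letter 0) =
        t1((i, Suc j') := t1 (Suc i, Suc j'), (Suc i, Suc j') := Letter 0)"
      using right by simp
    have "t2 (Suc i, Suc j') = t1 (Suc i, j')" "t2 (i, Suc j') = t1 (Suc i, Suc j')"
      using fun_cong[OF e, of "(Suc i, j')"] fun_cong[OF e, of "(i, Suc j')"] by auto
    moreover have "t2 (i, Suc j') < t2 (Suc i, Suc j')"
      using filling_col[OF f1, of i "Suc i" "Suc j'"] right by auto
    moreover have "t1 (Suc i, j') \<le> t1 (Suc i, Suc j')"
      using filling_row[OF f2, of j' "Suc j'" "Suc i"] right by auto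
    ultimately show ?thesis by simp
  next
    case (down t2)
    have f1: "filling n {(i, j)} \<mu> t1" using v(1) \<open>s1 = _\<close> by simp
    have f2: "filling n {(i, j)} \<mu> t2" using v(2) \<open>s2 = _\<close> by simp
    have e: "t1((i, j) := t1 (Suc i, j), (Suc i, j) := Letter 0) = t2((i, j) := t2 (Suc i, j), (Suc i, j) := Letter 0)"
      using down by simp
    have "t1 x = t2 x" for x
      using fun_cong[OF e, of x] fun_cong[OF e, of "(i, j)"] filling_outside[OF f1, of i j] filling_outside[OF f2, of i j]
      by (cases "x = (i, j)"; cases "x = (Suc i, j)") auto
    then show ?thesis using \<open>s1 = _\<close> \<open>s2 = _\<close> by auto
  qed
next
  case (finish j i t1)
  from s(2)[unfolded finish(2)] show ?thesis
  proof cases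
    case (append r2 t2 c2)
    then have "\<mu>(r2 := Suc (\<mu> r2)) = \<mu>(i := j)" by simp
    from fun_cong[OF this, of r2] show ?thesis using \<open>Suc j = \<mu> i\<close> by (auto split: if_splits)
  next
    case (finish j' i')
    have "\<mu>(i := j) = \<mu>(i' := j')" using finish by simp
    from fun_cong[OF this, of i] have "i = i' \<and> j = j'"
      using \<open>Suc j = \<mu> i\<close> \<open>Suc j' = \<mu> i'\<close> by (auto split: if_splits)
    then show ?thesis using \<open>s1 = _\<close> \<open>s2 = _\<close> by simp
  qed
qed

section \<open>Runs: existence of an end and of a unique beginning\<close>

definition run :: "nat \<Rightarrow> (nat \<Rightarrow> nat) \<Rightarrow> (state \<times> state) set" where
  "run n \<mu> = {(s, s'). valid n \<mu> s \<and> step \<mu> s s'}"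

lemma run_valid: "(s, s') \<in> (run n \<mu>)\<^sup>* \<Longrightarrow> is_partition \<mu> \<Longrightarrow> valid n \<mu> s \<Longrightarrow> valid n \<mu> s'"
  by (induction rule: rtrancl_induct) (auto simp: run_def intro: valid_step)

lemma run_left_unique: "is_partition \<mu> \<Longrightarrow> single_valued ((run n \<mu>)\<inverse>)"
  unfolding single_valued_def run_def by (auto intro: step_left_unique)

text \<open>A slide moves the hole right or down and so raises \<open>i + j\<close> by one; the
  extra one lets a cancellation raise the rank as well. The value at \<open>Done\<close> is a mere
  default.\<close>

fun rank :: "state \<Rightarrow> nat" where
  "rank (Ins r c t) = r"
| "rank (Slide i j t) = Suc (i + j)"
| "rank (Done \<nu> t) = 0"

lemma step_rank: "step \<mu> s s' \<Longrightarrow> (\<And>\<nu> t. s' \<noteq> Done \<nu> t) \<Longrightarrow> rank s' = Suc (rank s)"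
  by (cases rule: step.cases) auto

lemma rank_bounded:
  assumes p: "is_partition \<mu>"
  shows "\<exists>B. \<forall>s. valid n \<mu> s \<longrightarrow> rank s \<le> B"
proof -
  obtain B where B: "\<And>i. B \<le> i \<Longrightarrow> \<mu> i = 0" using finite_support_bound[OF p] by blast
  have "rank s \<le> Suc (B + \<mu> 0)" if "valid n \<mu> s" for s
  proof (cases s)
    case (Ins r c t)
    have "r \<le> B"
    proof (cases r)
      case (Suc i)
      then show ?thesis using that Ins B[of i] by (cases "B \<le> i") auto
    qed simp
    then show ?thesis using Ins by simp
  next
    case (Slide i j t)
    then have "j < \<mu> i" using that by simp
    then show ?thesis using B[of i] partition_mono[OF p, of 0 i] Slide by (cases "B \<le> i") auto
  qed simp
  then show ?thesis by blast
qed

lemma run_terminates: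
  assumes p: "is_partition \<mu>" and v: "valid n \<mu> s"
  shows "\<exists>\<nu> t. (s, Done \<nu> t) \<in> (run n \<mu>)\<^sup>*"
proof -
  obtain B where B: "\<And>s. valid n \<mu> s \<Longrightarrow> rank s \<le> B" using rank_bounded[OF p] by blast
  show ?thesis using v
  proof (induction "B - rank s" arbitrary: s rule: less_induct)
    case less
    show ?case
    proof (cases "\<exists>\<nu> t. s = Done \<nu> t")
      case False
      then obtain s' where s': "step \<mu> s s'" using step_exists[OF p less.prems] by blast
      then have v': "valid n \<mu> s'" using valid_step[OF p less.prems] by blast
      have r: "(s, s') \<in> run n \<mu>" using s' less.prems by (simp add: run_def)
      show ?thesis
      proof (cases "\<exists>\<nu> t. s' = Done \<nu> t")
        case False
        then have "rank s' = Suc (rank s)" using step_rank[OF s'] by blast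
        then have "B - rank s' < B - rank s" using B[OF v'] by simp
        from less.hyps[OF this v'] show ?thesis using r by (meson converse_rtrancl_into_rtrancl)
      qed (use r in auto)
    qed auto
  qed
qed

lemma run_from_start:
  assumes p: "is_partition \<mu>" and n: "\<And>i. 0 < \<mu> i \<Longrightarrow> i < n" and v: "valid n \<mu> s"
  shows "\<exists>c t. valid n \<mu> (Ins 0 c t) \<and> (Ins 0 c t, s) \<in> (run n \<mu>)\<^sup>*"
proof -
  \<comment> \<open>A final state has no meaningful rank, so the induction covers the other states,
    and a final one is first taken a single step back.\<close>
  have *: "\<exists>c t. valid n \<mu> (Ins 0 c t) \<and> (Ins 0 c t, s) \<in> (run n \<mu>)\<^sup>*"
    if "valid n \<mu> s" "\<And>\<nu> t. s \<noteq> Done \<nu> t" for s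
    using that
  proof (induction "rank s" arbitrary: s rule: less_induct)
    case less
    show ?case
    proof (cases "\<exists>c t. s = Ins 0 c t")
      case False
      then obtain s' where s': "valid n \<mu> s'" "step \<mu> s' s"
        using step_backward[OF p n less.prems(1)] by blast
      have nd: "s' \<noteq> Done \<nu> t" for \<nu> t using s' by (auto elim: step.cases)
      have "rank s' < rank s" using step_rank[OF s'(2)] less.prems by simp
      from less.hyps[OF this s'(1) nd] s' show ?thesis
        by (auto simp: run_def intro: rtrancl_into_rtrancl)
    qed (use less.prems in blast)
  qed
  show ?thesis
  proof (cases "\<exists>\<nu> t. s = Done \<nu> t")
    case True
    then obtain s' where s': "valid n \<mu> s'" "step \<mu> s' s"
      using step_backward[OF p n v] by blast
    have nd: "s' \<noteq> Done \<nu> t" for \<nu> t using s' by (auto elim: step.cases)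
    from *[OF s'(1) nd] s' show ?thesis
      by (auto simp: run_def intro: rtrancl_into_rtrancl)
  qed (use * v in blast)
qed

text \<open>Backwards a run is deterministic, so of two backward runs from \<open>s\<close> one
  continues the other; but nothing precedes an insertion into the top row.\<close>

lemma run_start_unique:
  assumes p: "is_partition \<mu>"
    and r: "(Ins 0 c1 t1, s) \<in> (run n \<mu>)\<^sup>*" "(Ins 0 c2 t2, s) \<in> (run n \<mu>)\<^sup>*"
  shows "c1 = c2 \<and> t1 = t2"
proof -
  have no: "x = Ins 0 c t" if "(x, Ins 0 c t) \<in> (run n \<mu>)\<^sup>*" for x c t
    using that by (cases rule: rtranclE) (auto simp: run_def not_step_Ins_0)
  have "(s, Ins 0 c1 t1) \<in> ((run n \<mu>)\<inverse>)\<^sup>*" "(s, Ins 0 c2 t2) \<in> ((run n \<mu>)\<inverse>)\<^sup>*"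
    using r by (auto simp: rtrancl_converse)
  from single_valued_confluent[OF run_left_unique[OF p] this]
  show ?thesis using no by (auto simp: rtrancl_converse)
qed

subsection \<open>Weights and lists of rows\<close>

definition cells :: "(nat \<Rightarrow> nat) \<Rightarrow> (nat \<times> nat) set" where
  "cells \<mu> = {(i, j). j < \<mu> i}"

text \<open>The value at the placeholder \<^term>\<open>Letter 0\<close> makes a hole weightless.\<close>

fun letter_weight :: "(nat \<Rightarrow> real) \<Rightarrow> letter \<Rightarrow> real" where
  "letter_weight a (Letter l) = (if l = 0 then 1 else a l)"
| "letter_weight a (Bar l) = inverse (a l)"

definition filling_weight :: "(nat \<Rightarrow> real) \<Rightarrow> (nat \<Rightarrow> nat) \<Rightarrow> (nat \<times> nat \<Rightarrow> letter) \<Rightarrow> real" where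
  "filling_weight a \<mu> t = (\<Prod>p\<in>cells \<mu>. letter_weight a (t p))"

fun state_weight :: "(nat \<Rightarrow> real) \<Rightarrow> (nat \<Rightarrow> nat) \<Rightarrow> state \<Rightarrow> real" where
  "state_weight a \<mu> (Ins r c t) = letter_weight a c * filling_weight a \<mu> t"
| "state_weight a \<mu> (Slide i j t) = filling_weight a \<mu> t"
| "state_weight a \<mu> (Done \<nu> t) = filling_weight a \<nu> t"

lemma finite_cells:
  assumes p: "is_partition \<mu>"
  shows "finite (cells \<mu>)"
proof -
  obtain B where B: "\<And>i. B \<le> i \<Longrightarrow> \<mu> i = 0" using finite_support_bound[OF p] by blast
  have "cells \<mu> \<subseteq> {..<B} \<times> {..<\<mu> 0}"
  proof (clarsimp simp: cells_def)
    fix i j assume "j < \<mu> i"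
    then show "i < B \<and> j < \<mu> 0" using B[of i] partition_mono[OF p, of 0 i] by (cases "B \<le> i") auto
  qed
  then show ?thesis by (rule finite_subset) simp
qed

text \<open>Multiplied out, the identity survives vanishing letter weights, and it is literally the
  invariance of the weight under a bump.\<close>

lemma filling_weight_upd:
  assumes "is_partition \<mu>" "j < \<mu> i"
  shows "filling_weight a \<mu> (t((i, j) := x)) * letter_weight a (t (i, j))
    = filling_weight a \<mu> t * letter_weight a x"
proof -
  have c: "(i, j) \<in> cells \<mu>" using assms by (simp add: cells_def)
  have "(\<Prod>p\<in>cells \<mu> - {(i, j)}. letter_weight a ((t((i, j) := x)) p))
     = (\<Prod>p\<in>cells \<mu> - {(i, j)}. letter_weight a (t p))"
    by (rule prod.cong) auto
  then show ?thesis unfolding filling_weight_def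
    using prod.remove[OF finite_cells[OF assms(1)] c, of "\<lambda>p. letter_weight a ((t((i, j) := x)) p)"]
      prod.remove[OF finite_cells[OF assms(1)] c, of "\<lambda>p. letter_weight a (t p)"] by (simp del: fun_upd_apply) (simp add: mult_ac)
qed

lemma letter_weight_pos:
  assumes "\<And>i. i \<in> {1..n} \<Longrightarrow> 0 < a i" "x \<in> alphabet n"
  shows "0 < letter_weight a x"
  using assms by (auto simp: alphabet_def)

lemma filling_weight_swap:
  assumes p: "is_partition \<mu>" and a: "\<And>i. i \<in> {1..n} \<Longrightarrow> 0 < a i"
    and c: "j < \<mu> i" "j' < \<mu> i'" "(i, j) \<noteq> (i', j')" "t (i, j) = Letter 0" "t (i', j') \<in> alphabet n"
  shows "filling_weight a \<mu> (t((i, j) := t (i', j'), (i', j') := Letter 0)) = filling_weight a \<mu> t"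
proof -
  have "letter_weight a (t (i', j')) \<noteq> 0" using letter_weight_pos[of n a, OF a c(5)] by simp
  then show ?thesis
    using filling_weight_upd[OF p c(1), of a t "t (i', j')"]
      filling_weight_upd[OF p c(2), of a "t((i, j) := t (i', j'))" "Letter 0"] c(3,4) by auto
qed

lemma filling_weight_append:
  assumes p: "is_partition \<mu>"
  shows "filling_weight a (\<mu>(r := Suc (\<mu> r))) (t((r, \<mu> r) := c)) = letter_weight a c * filling_weight a \<mu> t"
proof -
  have "cells (\<mu>(r := Suc (\<mu> r))) = insert (r, \<mu> r) (cells \<mu>)"
    by (auto simp: cells_def split: if_splits)
  moreover have "(r, \<mu> r) \<notin> cells \<mu>" by (simp add: cells_def)
  moreover have "(\<Prod>p\<in>cells \<mu>. letter_weight a ((t((r, \<mu> r) := c)) p)) = (\<Prod>p\<in>cells \<mu>. letter_weight a (t p))"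
    by (rule prod.cong) (auto simp: cells_def)
  ultimately show ?thesis using finite_cells[OF p] by (simp add: filling_weight_def del: fun_upd_apply) simp
qed

lemma filling_weight_finish:
  assumes p: "is_partition \<mu>" and j: "Suc j = \<mu> i" and t: "t (i, j) = Letter 0"
  shows "filling_weight a (\<mu>(i := j)) t = filling_weight a \<mu> t"
proof -
  have "cells \<mu> = insert (i, j) (cells (\<mu>(i := j)))"
    using j by (auto simp: cells_def less_Suc_eq split: if_splits)
  moreover have "(i, j) \<notin> cells (\<mu>(i := j))" by (simp add: cells_def)
  moreover have "finite (cells (\<mu>(i := j)))"
    using calculation(1) finite_cells[OF p] by simp
  ultimately show ?thesis using t by (simp add: filling_weight_def)
qed

lemma step_weight:
  assumes p: "is_partition \<mu>" and a: "\<And>i. i \<in> {1..n} \<Longrightarrow> 0 < a i"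
    and v: "valid n \<mu> s" and s: "step \<mu> s s'"
  shows "state_weight a \<mu> s' = state_weight a \<mu> s"
  using s
proof cases
  case (bump k r t c)
  then show ?thesis using filling_weight_upd[OF p, of k r a t c] by (simp add: mult.commute)
next
  case (append r t c)
  then show ?thesis using filling_weight_append[OF p] by simp
next
  case (cancel k r t)
  let ?L = "Letter (Suc r)" and ?t = "t((r, k) := Letter (Suc r))"
  have "?L \<in> alphabet n" using v cancel by simp
  then have pos: "0 < a (Suc r)" using a by (auto simp: alphabet_def)
  have k: "k < \<mu> r" "0 < \<mu> r" using cancel by auto
  \<comment> \<open>By the update if \<open>k = 0\<close>, by hypothesis otherwise. Turning the
    barred letter into the unbarred one multiplies the weight by the square of
    \<open>a (Suc r)\<close>, and emptying this box divides by \<open>a (Suc r)\<close>; what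
    remains is the weight of the inserted letter.\<close>
  have "?t (r, 0) = ?L" using cancel by (cases k) auto
  then show ?thesis
    using filling_weight_upd[OF p k(1), of a t ?L] filling_weight_upd[OF p k(2), of a ?t "Letter 0"]
      cancel pos by (simp del: fun_upd_apply add: field_simps)
next
  case (right j i t)
  then have f: "filling n {(i, j)} \<mu> t" "j < \<mu> i" using v by auto
  show ?thesis
    using filling_weight_swap[OF p a, where t = t and i = i and i' = i and j = j and j' = "Suc j"] right f
      filling_outside[OF f(1), of i j] filling_alphabet[OF f(1), of "Suc j" i] by simp
next
  case (down j i t)
  then have f: "filling n {(i, j)} \<mu> t" "j < \<mu> i" using v by auto
  show ?thesis
    using filling_weight_swap[OF p a, where t = t and i = i and i' = "Suc i" and j = j and j' = j] down f
      filling_outside[OF f(1), of i j] filling_alphabet[OF f(1), of j "Suc i"] by simp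
next
  case (finish j i t)
  then have f: "filling n {(i, j)} \<mu> t" "j < \<mu> i" using v by auto
  show ?thesis using filling_weight_finish[OF p] finish filling_outside[OF f(1), of i j] by simp
qed

section \<open>Translation between fillings and lists of rows\<close>

lemma nat_eqI_less: "(\<And>k. k < a \<longleftrightarrow> k < b) \<Longrightarrow> a = (b :: nat)"
  by (metis less_irrefl nat_neq_iff)

definition num_rows :: "(nat \<Rightarrow> nat) \<Rightarrow> nat" where
  "num_rows \<mu> = card {i. \<mu> i \<noteq> 0}"

text \<open>The nonzero parts form an initial segment, so their number is the index of the first
  zero part.\<close>

lemma less_num_rows_iff:
  assumes p: "is_partition \<mu>"
  shows "i < num_rows \<mu> \<longleftrightarrow> 0 < \<mu> i"
proof -
  define B where "B = (LEAST i. \<mu> i = 0)"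
  obtain B' where "\<And>i. B' \<le> i \<Longrightarrow> \<mu> i = 0" using finite_support_bound[OF p] by blast
  then have B: "\<mu> B = 0" unfolding B_def by (intro LeastI_ex[of "\<lambda>i. \<mu> i = 0"]) auto
  have "{i. \<mu> i \<noteq> 0} = {..<B}"
  proof (intro set_eqI iffI)
    fix i assume "i \<in> {i. \<mu> i \<noteq> 0}"
    then show "i \<in> {..<B}" using partition_mono[OF p, of B i] B by (cases "B \<le> i") auto
  next
    fix i assume "i \<in> {..<B}"
    then show "i \<in> {i. \<mu> i \<noteq> 0}" using not_less_Least[of i "\<lambda>i. \<mu> i = 0"] by (auto simp: B_def)
  qed
  then show ?thesis by (auto simp: num_rows_def)
qed

definition tableau_of :: "(nat \<Rightarrow> nat) \<Rightarrow> (nat \<times> nat \<Rightarrow> letter) \<Rightarrow> tableau" where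
  "tableau_of \<mu> t = map (\<lambda>i. map (\<lambda>j. t (i, j)) [0..<\<mu> i]) [0..<num_rows \<mu>]"

lemma length_tableau_of [simp]: "length (tableau_of \<mu> t) = num_rows \<mu>"
  by (simp add: tableau_of_def)

lemma nth_tableau_of: "i < num_rows \<mu> \<Longrightarrow> tableau_of \<mu> t ! i = map (\<lambda>j. t (i, j)) [0..<\<mu> i]"
  by (simp add: tableau_of_def)

lemma nth_nth_tableau_of: "is_partition \<mu> \<Longrightarrow> j < \<mu> i \<Longrightarrow> tableau_of \<mu> t ! i ! j = t (i, j)"
  by (simp add: nth_tableau_of less_num_rows_iff)

lemma has_box_tableau_of: "is_partition \<mu> \<Longrightarrow> has_box (tableau_of \<mu> t) i j \<longleftrightarrow> j < \<mu> i"
  by (auto simp: has_box_def less_num_rows_iff nth_tableau_of)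

lemma shape_tableau_of: "is_partition \<mu> \<Longrightarrow> shape (tableau_of \<mu> t) = \<mu>"
  by (auto simp: shape_def nth_tableau_of less_num_rows_iff)

lemma tableau_of_upd:
  assumes "is_partition \<mu>" "j < \<mu> i"
  shows "(tableau_of \<mu> t)[i := (tableau_of \<mu> t ! i)[j := x]] = tableau_of \<mu> (t((i, j) := x))"
proof (rule nth_equalityI)
  fix k assume k: "k < length ((tableau_of \<mu> t)[i := (tableau_of \<mu> t ! i)[j := x]])"
  show "(tableau_of \<mu> t)[i := (tableau_of \<mu> t ! i)[j := x]] ! k = tableau_of \<mu> (t((i, j) := x)) ! k"
    using k assms by (cases "k = i") (auto simp: nth_tableau_of nth_list_update intro!: nth_equalityI)
qed simp

lemma symplectic_tableau_of:
  assumes p: "is_partition \<mu>" and f: "filling n {} \<mu> t"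
  shows "symplectic_tableau n (tableau_of \<mu> t)"
  unfolding symplectic_tableau_def
proof (intro conjI ballI allI impI)
  fix row assume "row \<in> set (tableau_of \<mu> t)"
  then obtain i where i: "i < num_rows \<mu>" "row = map (\<lambda>j. t (i, j)) [0..<\<mu> i]"
    by (auto simp: tableau_of_def)
  show "row \<noteq> []" using i less_num_rows_iff[OF p] by auto
  show "set row \<subseteq> alphabet n" using i filling_alphabet[OF f] by auto
  show "sorted row" using i by (auto simp: sorted_iff_nth_mono intro: filling_row_le[OF f])
next
  fix i j assume a: "has_box (tableau_of \<mu> t) (Suc i) j"
  then show "tableau_of \<mu> t ! i ! j < tableau_of \<mu> t ! Suc i ! j"
    using filling_col[OF f, of i "Suc i" j] partition_mono[OF p, of i "Suc i"]
    by (auto simp: has_box_tableau_of[OF p] nth_nth_tableau_of[OF p])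
next
  fix i j assume a: "has_box (tableau_of \<mu> t) i j"
  then show "Letter (Suc i) \<le> tableau_of \<mu> t ! i ! j"
    using filling_ge[OF f, of j i] by (auto simp: has_box_tableau_of[OF p] nth_nth_tableau_of[OF p])
qed (simp add: shape_tableau_of p)

lemma symplectic_is_tableau_of:
  assumes s: "symplectic_tableau n P"
  obtains t where "filling n {} (shape P) t" "P = tableau_of (shape P) t"
proof -
  let ?\<mu> = "shape P" and ?t = "\<lambda>(i, j). if has_box P i j then P ! i ! j else Letter 0"
  have p: "is_partition ?\<mu>" using s by (simp add: symplectic_tableau_def)
  have b: "has_box P i j \<longleftrightarrow> j < ?\<mu> i" for i j by (auto simp: has_box_def shape_def)
  have rs: "P ! i \<noteq> []" "set (P ! i) \<subseteq> alphabet n" "sorted (P ! i)" if "i < length P" for i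
    using s that nth_mem[of i P] by (auto simp: symplectic_tableau_def)
  have "filling n {} ?\<mu> ?t"
  proof (rule fillingI)
    fix i j assume "j < ?\<mu> i"
    then have h: "has_box P i j" by (simp add: b)
    then show "?t (i, j) \<in> alphabet n" using rs(2)[of i] nth_mem[of j "P ! i"] by (auto simp: has_box_def)
    show "Letter (Suc i) \<le> ?t (i, j)" using h s by (auto simp: symplectic_tableau_def)
  next
    fix i j j' assume "j < j'" "j' < ?\<mu> i"
    then show "?t (i, j) \<le> ?t (i, j')"
      using b[of i j] b[of i j'] rs(3)[of i] by (auto simp: has_box_def intro: sorted_nth_mono)
  next
    \<comment> \<open>Symplectic tableaux compare vertical neighbours only; \<open>filling\<close>
      compares all pairs, so that something remains to be said across a hole.\<close>
    fix i i' j assume "i < i'" "j < ?\<mu> i'"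
    then show "?t (i, j) < ?t (i', j)"
    proof (induction i')
      case (Suc i')
      have h: "has_box P (Suc i') j" using Suc b by simp
      moreover have h': "has_box P i' j" using Suc b partition_mono[OF p, of i' "Suc i'"] by simp
      ultimately have "?t (i', j) < ?t (Suc i', j)" using s by (auto simp: symplectic_tableau_def)
      moreover have "?t (i, j) \<le> ?t (i', j)"
        using Suc h' b by (cases "i = i'") auto
      ultimately show ?case by simp
    qed simp
  qed (use b in auto)
  moreover have "P = tableau_of ?\<mu> ?t"
  proof (rule nth_equalityI)
    have "i < num_rows ?\<mu> \<longleftrightarrow> i < length P" for i
      using less_num_rows_iff[OF p, of i] rs(1)[of i] by (auto simp: shape_def)
    then show l: "length P = length (tableau_of ?\<mu> ?t)"
      unfolding length_tableau_of by (intro nat_eqI_less) simp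
    fix i assume i: "i < length P"
    have nr: "i < num_rows ?\<mu>" using i unfolding l[symmetric, unfolded length_tableau_of] .
    have len: "?\<mu> i = length (P ! i)" using i by (simp add: shape_def)
    have "tableau_of ?\<mu> ?t ! i = map (\<lambda>j. ?t (i, j)) [0..<length (P ! i)]"
      by (simp only: nth_tableau_of[OF nr] len)
    also have "\<dots> = P ! i"
      using i by (intro nth_equalityI) (auto simp: has_box_def)
    finally show "P ! i = tableau_of ?\<mu> ?t ! i" by simp
  qed
  ultimately show thesis by (rule that)
qed

lemma tableau_of_inj:
  assumes p: "is_partition \<mu>" and f: "filling n {} \<mu> t1" "filling n {} \<mu> t2"
    and e: "tableau_of \<mu> t1 = tableau_of \<mu> t2"
  shows "t1 = t2"
proof
  fix x :: "nat \<times> nat"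
  obtain i j where x: "x = (i, j)" by (cases x)
  show "t1 x = t2 x"
    using nth_nth_tableau_of[OF p, of j i t1] nth_nth_tableau_of[OF p, of j i t2] e
      filling_outside[OF f(1), of i j] filling_outside[OF f(2), of i j] x
    by (cases "j < \<mu> i") auto
qed

lemma delete_box_tableau_of:
  assumes p: "is_partition \<mu>" and q: "is_partition (\<mu>(i := j))" and j: "Suc j = \<mu> i"
  shows "delete_box (tableau_of \<mu> t) i = tableau_of (\<mu>(i := j)) t"
proof -
  let ?P = "tableau_of \<mu> t" and ?Q = "tableau_of (\<mu>(i := j)) t"
  have i: "i < num_rows \<mu>" using less_num_rows_iff[OF p, of i] j by simp
  have row: "?P ! i = map (\<lambda>j. t (i, j)) [0..<j] @ [t (i, j)]"
    using nth_tableau_of[OF i] by (simp add: j[symmetric])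
  show ?thesis
  proof (cases "j = 0")
    case False
    have "k < num_rows (\<mu>(i := j)) \<longleftrightarrow> k < num_rows \<mu>" for k
      using less_num_rows_iff[OF p, of k] less_num_rows_iff[OF q, of k] False j by auto
    then have l: "num_rows (\<mu>(i := j)) = num_rows \<mu>" by (rule nat_eqI_less)
    have "?P[i := butlast (?P ! i)] = ?Q"
    proof (rule nth_equalityI)
      fix k assume "k < length (?P[i := butlast (?P ! i)])"
      then show "?P[i := butlast (?P ! i)] ! k = ?Q ! k"
        using l row i by (cases "k = i") (auto simp: nth_tableau_of)
    qed (simp add: l)
    moreover have "filter (\<lambda>row. row \<noteq> []) ?Q = ?Q"
      using less_num_rows_iff[OF q] by (auto simp: filter_id_conv tableau_of_def split: if_splits)
    ultimately show ?thesis by (simp add: delete_box_def)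
  next
    case True
    \<comment> \<open>A row of one box disappears altogether; since the result is still a partition,
      it was the last row.\<close>
    have "k < num_rows \<mu> \<longleftrightarrow> k < Suc i" for k
      using less_num_rows_iff[OF p, of k] partition_mono[OF p, of k i] partition_mono[OF q, of i k] j True
      by (cases "k \<le> i") auto
    then have l: "num_rows \<mu> = Suc i" by (rule nat_eqI_less)
    have "k < num_rows (\<mu>(i := j)) \<longleftrightarrow> k < i" for k
      using less_num_rows_iff[OF q, of k] less_num_rows_iff[OF p, of k] l True by auto
    then have l': "num_rows (\<mu>(i := j)) = i" by (rule nat_eqI_less)
    have "\<mu> i = 1" using True j by simp
    then have P: "?P = ?Q @ [[t (i, 0)]]"
      unfolding tableau_of_def l l' by simp
    have "filter (\<lambda>row. row \<noteq> []) ?Q = ?Q"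
      using less_num_rows_iff[OF q] by (auto simp: filter_id_conv tableau_of_def split: if_splits)
    then show ?thesis by (simp add: delete_box_def P l' list_update_append nth_append)
  qed
qed

lemma append_tableau_of:
  assumes p: "is_partition \<mu>" and q: "is_partition (\<mu>(r := Suc (\<mu> r)))"
  shows "tableau_of (\<mu>(r := Suc (\<mu> r))) (t((r, \<mu> r) := c)) =
    (if num_rows \<mu> \<le> r then tableau_of \<mu> t @ [[c]]
     else (tableau_of \<mu> t)[r := tableau_of \<mu> t ! r @ [c]])" (is "?Q = _")
proof (cases "\<mu> r = 0")
  case True
  then have r: "num_rows \<mu> \<le> r" using less_num_rows_iff[OF p, of r] by simp
  have "k < num_rows (\<mu>(r := Suc (\<mu> r))) \<longleftrightarrow> k < Suc r" for k
    using less_num_rows_iff[OF q, of k] partition_mono[OF q, of k r] partition_mono[OF p, of r k] True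
    by (cases "k \<le> r") auto
  then have l: "num_rows (\<mu>(r := Suc (\<mu> r))) = Suc r" by (rule nat_eqI_less)
  have "k < num_rows \<mu> \<longleftrightarrow> k < r" for k
    using less_num_rows_iff[OF q, of k] less_num_rows_iff[OF p, of k] l True by (cases "k = r") auto
  then have l': "num_rows \<mu> = r" by (rule nat_eqI_less)
  show ?thesis using True unfolding tableau_of_def l l' by simp
next
  case False
  then have r: "r < num_rows \<mu>" using less_num_rows_iff[OF p, of r] by simp
  have "k < num_rows (\<mu>(r := Suc (\<mu> r))) \<longleftrightarrow> k < num_rows \<mu>" for k
    using less_num_rows_iff[OF p, of k] less_num_rows_iff[OF q, of k] False by auto
  then have l: "num_rows (\<mu>(r := Suc (\<mu> r))) = num_rows \<mu>" by (rule nat_eqI_less)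
  have "?Q = (tableau_of \<mu> t)[r := tableau_of \<mu> t ! r @ [c]]"
  proof (rule nth_equalityI)
    fix k assume "k < length ?Q"
    then show "?Q ! k = (tableau_of \<mu> t)[r := tableau_of \<mu> t ! r @ [c]] ! k"
      using l r by (cases "k = r") (auto simp: nth_tableau_of)
  qed (simp add: l)
  then show ?thesis using r by simp
qed

subsection \<open>Berele insertion is a weight-preserving bijection\<close>

lemma jeu_de_taquin_right:
  assumes "is_partition \<mu>" "Suc j < \<mu> i" "j < \<mu> (Suc i) \<longrightarrow> t (i, Suc j) < t (Suc i, j)"
  shows "jeu_de_taquin (tableau_of \<mu> t) i j = jeu_de_taquin (tableau_of \<mu> (t((i, j) := t (i, Suc j)))) i (Suc j)"
  using assms
  by (subst jeu_de_taquin.simps) (simp add: has_box_tableau_of nth_nth_tableau_of tableau_of_upd)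

lemma jeu_de_taquin_down:
  assumes "is_partition \<mu>" "j < \<mu> (Suc i)" "Suc j < \<mu> i \<longrightarrow> t (Suc i, j) \<le> t (i, Suc j)"
  shows "jeu_de_taquin (tableau_of \<mu> t) i j = jeu_de_taquin (tableau_of \<mu> (t((i, j) := t (Suc i, j)))) (Suc i) j"
proof -
  have "j < \<mu> i" using assms(2) partition_mono[OF assms(1), of i "Suc i"] by simp
  then show ?thesis using assms
    by (subst jeu_de_taquin.simps) (auto simp: has_box_tableau_of nth_nth_tableau_of tableau_of_upd)
qed

lemma jeu_de_taquin_finish:
  assumes "is_partition \<mu>" "\<mu> i \<le> Suc j" "\<mu> (Suc i) \<le> j"
  shows "jeu_de_taquin (tableau_of \<mu> t) i j = delete_box (tableau_of \<mu> t) i"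
  using assms by (subst jeu_de_taquin.simps) (simp add: has_box_tableau_of)

text \<open>The list keeps a stale letter in the hole where a state has the placeholder. The
  direction of the slide depends only on the neighbours, and the letter is overwritten or cut off,
  so the two agree.\<close>

lemma jeu_de_taquin_hole:
  assumes p: "is_partition \<mu>" and j: "j < \<mu> i"
  shows "jeu_de_taquin (tableau_of \<mu> (t((i, j) := x))) i j = jeu_de_taquin (tableau_of \<mu> t) i j"
proof -
  consider "Suc j < \<mu> i \<and> (j < \<mu> (Suc i) \<longrightarrow> t (i, Suc j) < t (Suc i, j))"
    | "j < \<mu> (Suc i) \<and> (Suc j < \<mu> i \<longrightarrow> t (Suc i, j) \<le> t (i, Suc j))"
    | "\<mu> i \<le> Suc j \<and> \<mu> (Suc i) \<le> j" by force
  then show ?thesis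
  proof cases
    case 1
    then show ?thesis
      using jeu_de_taquin_right[OF p, of j i t] jeu_de_taquin_right[OF p, of j i "t((i, j) := x)"] by simp
  next
    case 2
    then show ?thesis
      using jeu_de_taquin_down[OF p, of j i t] jeu_de_taquin_down[OF p, of j i "t((i, j) := x)"] by simp
  next
    case 3
    then have mi: "\<mu> i = Suc j" using j by simp
    have i: "i < num_rows \<mu>" using less_num_rows_iff[OF p, of i] j by simp
    have "delete_box (tableau_of \<mu> (t((i, j) := x))) i = delete_box (tableau_of \<mu> t) i"
      using i mi unfolding tableau_of_upd[OF p j, symmetric]
      by (simp add: delete_box_def butlast_list_update nth_tableau_of)
    then show ?thesis using 3 by (simp add: jeu_de_taquin_finish[OF p])
  qed
qed

lemma berele_bump:
  assumes p: "is_partition \<mu>" and k: "k < \<mu> r" "\<forall>j<k. t (r, j) \<le> c" "c < t (r, k)"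
  shows "berele_insert_from r c (tableau_of \<mu> t) =
    (if c = Letter (Suc r) \<and> t (r, k) = Bar (Suc r) then jeu_de_taquin (tableau_of \<mu> t) r k
     else berele_insert_from (Suc r) (t (r, k)) (tableau_of \<mu> (t((r, k) := c))))"
proof -
  let ?row = "tableau_of \<mu> t ! r"
  have r: "r < num_rows \<mu>" using less_num_rows_iff[OF p, of r] k by simp
  have row: "?row = map (\<lambda>j. t (r, j)) [0..<\<mu> r]" using nth_tableau_of[OF r] .
  have "takeWhile (\<lambda>x. x \<le> c) ?row = take k ?row"
    by (rule takeWhile_eq_take_P_nth) (use k row in auto)
  then have l: "length (takeWhile (\<lambda>x. x \<le> c) ?row) = k" using k row by simp
  have n: "?row ! k = t (r, k)" using k row by simp
  have "t (r, k) \<in> set ?row" using k row by auto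
  then have "(\<forall>x\<in>set ?row. x \<le> c) = False" using k by force
  then show ?thesis using r
    by (subst berele_insert_from.simps) (simp only: Let_def l n tableau_of_upd[OF p k(1)] length_tableau_of not_le[symmetric] if_False simp_thms)
qed

lemma berele_append:
  assumes p: "is_partition \<mu>" and q: "is_partition (\<mu>(r := Suc (\<mu> r)))" and k: "\<forall>j<\<mu> r. t (r, j) \<le> c"
  shows "berele_insert_from r c (tableau_of \<mu> t) = tableau_of (\<mu>(r := Suc (\<mu> r))) (t((r, \<mu> r) := c))"
  unfolding append_tableau_of[OF p q]
  using k by (subst berele_insert_from.simps) (auto simp: nth_tableau_of)

text \<open>The algorithm opens the hole at \<open>k\<close>, the abstract step at 0. From 0 the
  slide runs right through the block of \<open>Letter (Suc r)\<close>, since this letter is smaller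
  than all letters of the next row; shifting equal letters changes nothing, so it arrives at
  \<open>k\<close> with the same tableau.\<close>

lemma berele_cancel:
  assumes p: "is_partition \<mu>" and f: "filling n {} \<mu> t"
    and k: "k < \<mu> r" "\<forall>j<k. t (r, j) = Letter (Suc r)" "t (r, k) = Bar (Suc r)"
  shows "berele_insert_from r (Letter (Suc r)) (tableau_of \<mu> t)
    = jeu_de_taquin (tableau_of \<mu> (t((r, k) := Letter (Suc r), (r, 0) := Letter 0))) r 0"
proof -
  let ?L = "Letter (Suc r)" and ?t = "t((r, k) := Letter (Suc r))"
  have "jeu_de_taquin (tableau_of \<mu> ?t) r m = jeu_de_taquin (tableau_of \<mu> ?t) r k" if "m \<le> k" for m
    using that
  proof (induction m rule: inc_induct)
    case (step m)
    have "m < \<mu> (Suc r) \<longrightarrow> ?t (r, Suc m) < ?t (Suc r, m)"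
      using filling_ge[OF f, of m "Suc r"] step less_le_trans[OF Letter_ge_simps(4)[of r]] k
      by (cases "Suc m = k") auto
    moreover have "?t((r, m) := ?t (r, Suc m)) = ?t"
      using step k by (intro ext) (cases "Suc m = k"; auto)
    ultimately show ?case
      using jeu_de_taquin_right[OF p, of m r ?t] step k by (simp del: fun_upd_apply)
  qed simp
  from this[of 0] show ?thesis
    using berele_bump[OF p k(1), of t ?L] k Letter_ge_simps(2)[of r]
      jeu_de_taquin_hole[OF p, of 0 r ?t "Letter 0"] jeu_de_taquin_hole[OF p k(1), of t ?L]
    by simp
qed

text \<open>What the recursive functions return when resumed at a state. Its invariance ties the
  abstract runs to the actual algorithm.\<close>

fun state_result :: "(nat \<Rightarrow> nat) \<Rightarrow> state \<Rightarrow> tableau" where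
  "state_result \<mu> (Ins r c t) = berele_insert_from r c (tableau_of \<mu> t)"
| "state_result \<mu> (Slide i j t) = jeu_de_taquin (tableau_of \<mu> t) i j"
| "state_result \<mu> (Done \<nu> t) = tableau_of \<nu> t"

lemma step_result:
  assumes p: "is_partition \<mu>" and v: "valid n \<mu> s" and s: "step \<mu> s s'"
  shows "state_result \<mu> s' = state_result \<mu> s"
  using s
proof cases
  case (bump k r t c)
  then show ?thesis using berele_bump[OF p bump(3-5)] by simp
next
  case (append r t c)
  then show ?thesis using berele_append[OF p _ append(3)] valid_step[OF p v s] by simp
next
  case (cancel k r t)
  then show ?thesis using berele_cancel[OF p _ cancel(3-5), of n] v by simp
next
  case (right j i t)
  then show ?thesis
    using jeu_de_taquin_right[OF p right(3,4)] jeu_de_taquin_hole[OF p right(3)] by simp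
next
  case (down j i t)
  then show ?thesis
    using jeu_de_taquin_down[OF p down(3,4)] jeu_de_taquin_hole[OF p down(3)] by simp
next
  case (finish j i t)
  then show ?thesis
    using jeu_de_taquin_finish[OF p, of i j t] delete_box_tableau_of[OF p _ finish(3)] valid_step[OF p v s] by simp
qed

lemma run_invariants:
  assumes r: "(s, s') \<in> (run n \<mu>)\<^sup>*" and p: "is_partition \<mu>" and a: "\<And>i. i \<in> {1..n} \<Longrightarrow> 0 < a i"
  shows "state_result \<mu> s' = state_result \<mu> s" "state_weight a \<mu> s' = state_weight a \<mu> s"
  using r by (induction rule: rtrancl_induct)
    (use step_result[OF p] step_weight[OF p a] in \<open>auto simp: run_def\<close>)

section \<open>The weight of a tableau as a product over boxes\<close>

lemma powi_Suc_diff: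
  fixes x :: real assumes "0 < x"
  shows "x powi (int (Suc k) - int l) = x * x powi (int k - int l)"
    and "x powi (int k - int (Suc l)) = inverse x * x powi (int k - int l)"
proof -
  have e: "int (Suc k) - int l = 1 + (int k - int l)" "int k - int (Suc l) = -1 + (int k - int l)" by auto
  show "x powi (int (Suc k) - int l) = x * x powi (int k - int l)"
    unfolding e using assms by (subst power_int_add) auto
  show "x powi (int k - int (Suc l)) = inverse x * x powi (int k - int l)"
    unfolding e using assms by (subst power_int_add) (auto simp: power_int_minus)
qed

text \<open>Prepending a letter shifts only the exponent at its own index, by one up or
  down.\<close>

lemma word_weight:
  assumes a: "\<And>i. i \<in> {1..n} \<Longrightarrow> 0 < a i" and xs: "set xs \<subseteq> alphabet n"
  shows "(\<Prod>l = 1..n. a l powi (int (count_list xs (Letter l)) - int (count_list xs (Bar l))))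
    = prod_list (map (letter_weight a) xs)"
  using xs
proof (induction xs)
  case (Cons x xs)
  let ?f = "\<lambda>xs l. a l powi (int (count_list xs (Letter l)) - int (count_list xs (Bar l)))"
  obtain l where l: "l \<in> {1..n}" "x = Letter l \<or> x = Bar l" using Cons.prems by (auto simp: alphabet_def)
  have "prod (?f (x # xs)) ({1..n} - {l}) = prod (?f xs) ({1..n} - {l})"
    by (rule prod.cong) (use l in auto)
  moreover have "?f (x # xs) l = letter_weight a x * ?f xs l"
    using l powi_Suc_diff[OF a[OF l(1)]] by auto
  ultimately have "prod (?f (x # xs)) {1..n} = letter_weight a x * prod (?f xs) {1..n}"
    using prod.remove[of "{1..n}" l "?f (x # xs)"] prod.remove[of "{1..n}" l "?f xs"] l(1) by simp
  then show ?case using Cons by simp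
qed simp

lemma prod_list_concat: "prod_list (map f (concat xss)) = prod_list (map (\<lambda>xs. prod_list (map f xs)) xss)"
  for f :: "'a \<Rightarrow> real"
  by (induction xss) auto

lemma prod_list_upt: "prod_list (map f [0..<k]) = (\<Prod>i<k. f i)" for f :: "nat \<Rightarrow> real"
  using prod.distinct_set_conv_list[of "[0..<k]" f] by (simp add: atLeast0LessThan)

lemma tableau_weight_tableau_of:
  assumes a: "\<And>i. i \<in> {1..n} \<Longrightarrow> 0 < a i" and p: "is_partition \<mu>" and f: "filling n {} \<mu> t"
  shows "tableau_weight n a (tableau_of \<mu> t) = filling_weight a \<mu> t"
proof -
  have rows: "i < num_rows \<mu>" if "j < \<mu> i" for i j
    using that less_num_rows_iff[OF p, of i] by simp
  have "set (concat (tableau_of \<mu> t)) \<subseteq> alphabet n"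
    using symplectic_tableau_of[OF p f] by (auto simp: symplectic_tableau_def)
  then have "tableau_weight n a (tableau_of \<mu> t) = prod_list (map (letter_weight a) (concat (tableau_of \<mu> t)))"
    unfolding tableau_weight_def by (intro word_weight a)
  also have "\<dots> = (\<Prod>i<num_rows \<mu>. \<Prod>j<\<mu> i. letter_weight a (t (i, j)))"
    by (simp add: prod_list_concat tableau_of_def comp_def prod_list_upt)
  also have "\<dots> = (\<Prod>(i, j)\<in>Sigma {..<num_rows \<mu>} (\<lambda>i. {..<\<mu> i}). letter_weight a (t (i, j)))"
    by (rule prod.Sigma) auto
  also have "Sigma {..<num_rows \<mu>} (\<lambda>i. {..<\<mu> i}) = cells \<mu>"
    unfolding cells_def using rows by auto
  finally show ?thesis by (simp add: filling_weight_def)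
qed

section \<open>The bijection for tableaux\<close>

definition tableaux :: "nat \<Rightarrow> (nat \<Rightarrow> nat) \<Rightarrow> tableau set" where
  "tableaux n \<mu> = {P. symplectic_tableau n P \<and> shape P = \<mu>}"

definition neighbour_tableaux :: "nat \<Rightarrow> (nat \<Rightarrow> nat) \<Rightarrow> tableau set" where
  "neighbour_tableaux n \<mu> = {P. symplectic_tableau n P \<and> one_box_step \<mu> (shape P)}"

lemma partitions_upto_support: "\<mu> \<in> partitions_upto n \<longleftrightarrow> is_partition \<mu> \<and> (\<forall>i. 0 < \<mu> i \<longrightarrow> i < n)"
proof (cases "is_partition \<mu>")
  case True
  have "num_rows \<mu> \<le> n \<longleftrightarrow> (\<forall>i. i < num_rows \<mu> \<longrightarrow> i < n)" by (meson leI less_le_trans nat_less_le)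
  then show ?thesis
    using less_num_rows_iff[OF True] True by (simp add: partitions_upto_def num_rows_def)
qed (simp add: partitions_upto_def)

text \<open>The first letter of row \<open>i\<close> is at least \<open>Letter (Suc i)\<close> and
  lies in the alphabet, hence \<open>i < n\<close>.\<close>

lemma shape_symplectic:
  assumes "symplectic_tableau n P"
  shows "shape P \<in> partitions_upto n"
proof -
  have "i < n" if "0 < shape P i" for i
  proof -
    have h: "has_box P i 0" using that by (auto simp: has_box_def shape_def split: if_splits)
    then have "P ! i \<in> set P" "P ! i ! 0 \<in> set (P ! i)" by (auto simp: has_box_def)
    then have "Letter (Suc i) \<le> P ! i ! 0" "P ! i ! 0 \<in> alphabet n"
      using assms h unfolding symplectic_tableau_def by blast+
    then show ?thesis by (auto simp: alphabet_def less_eq_letter_def)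
  qed
  then show ?thesis using assms by (simp add: partitions_upto_support symplectic_tableau_def)
qed

lemma tableaux_iff:
  assumes p: "is_partition \<mu>"
  shows "P \<in> tableaux n \<mu> \<longleftrightarrow> (\<exists>t. filling n {} \<mu> t \<and> P = tableau_of \<mu> t)"
  unfolding tableaux_def using symplectic_tableau_of[OF p, of n] shape_tableau_of[OF p]
  by (auto elim: symplectic_is_tableau_of)

lemma berele_run:
  assumes p: "is_partition \<mu>" and c: "c \<in> alphabet n" and f: "filling n {} \<mu> t"
    and a: "\<And>i. i \<in> {1..n} \<Longrightarrow> 0 < a i"
  obtains \<nu> t' where "(Ins 0 c t, Done \<nu> t') \<in> (run n \<mu>)\<^sup>*"
    "berele_insert c (tableau_of \<mu> t) = tableau_of \<nu> t'" "valid n \<mu> (Done \<nu> t')"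
    "filling_weight a \<nu> t' = letter_weight a c * filling_weight a \<mu> t"
proof -
  have "Letter (Suc 0) \<le> c" using c by (auto simp: alphabet_def less_eq_letter_def)
  then have v: "valid n \<mu> (Ins 0 c t)" using c f by simp
  obtain \<nu> t' where r: "(Ins 0 c t, Done \<nu> t') \<in> (run n \<mu>)\<^sup>*"
    using run_terminates[OF p v] by blast
  show thesis
    using that[OF r] run_invariants[OF r p a] run_valid[OF r p v] by (simp add: berele_insert_def)
qed

lemma berele_weight:
  assumes P: "symplectic_tableau n P" and c: "c \<in> alphabet n"
    and a: "\<And>i. i \<in> {1..n} \<Longrightarrow> 0 < a i"
  shows "tableau_weight n a (berele_insert c P) = letter_weight a c * tableau_weight n a P"
proof -
  obtain t where t: "filling n {} (shape P) t" "P = tableau_of (shape P) t"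
    using symplectic_is_tableau_of[OF P] by blast
  have p: "is_partition (shape P)" using P by (simp add: symplectic_tableau_def)
  obtain \<nu> t' where "berele_insert c (tableau_of (shape P) t) = tableau_of \<nu> t'" "valid n (shape P) (Done \<nu> t')"
    "filling_weight a \<nu> t' = letter_weight a c * filling_weight a (shape P) t"
    using berele_run[OF p c t(1), of a, OF a] by blast
  then show ?thesis
    using t tableau_weight_tableau_of[of n a, OF a p t(1)] tableau_weight_tableau_of[of n a \<nu> t'] a by simp
qed

theorem berele_bijection:
  assumes \<mu>: "\<mu> \<in> partitions_upto n"
  shows "bij_betw (\<lambda>(c, P). berele_insert c P) (alphabet n \<times> tableaux n \<mu>) (neighbour_tableaux n \<mu>)"
proof -
  have p: "is_partition \<mu>" and n: "\<And>i. 0 < \<mu> i \<Longrightarrow> i < n" using \<mu> by (auto simp: partitions_upto_support)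
  \<comment> \<open>A tableau determines the final state that produces it: its shape gives \<nu>,
    and the placeholders make the filling unique.\<close>
  have valid_eq: "\<nu>1 = \<nu>2 \<and> t1 = t2" if "valid n \<mu> (Done \<nu>1 t1)" "valid n \<mu> (Done \<nu>2 t2)"
    "tableau_of \<nu>1 t1 = tableau_of \<nu>2 t2" for \<nu>1 \<nu>2 t1 t2
    using that shape_tableau_of[of \<nu>1 t1] shape_tableau_of[of \<nu>2 t2] tableau_of_inj[of \<nu>1 n t1 t2] by auto
  show ?thesis
    unfolding bij_betw_def
  proof (intro conjI inj_onI set_eqI iffI)
    fix x y assume "x \<in> alphabet n \<times> tableaux n \<mu>" "y \<in> alphabet n \<times> tableaux n \<mu>"
      and e: "(case x of (c, P) \<Rightarrow> berele_insert c P) = (case y of (c, P) \<Rightarrow> berele_insert c P)"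
    then obtain c1 t1 c2 t2 where x: "x = (c1, tableau_of \<mu> t1)" "c1 \<in> alphabet n" "filling n {} \<mu> t1"
      and y: "y = (c2, tableau_of \<mu> t2)" "c2 \<in> alphabet n" "filling n {} \<mu> t2"
      by (auto simp: tableaux_iff[OF p])
    \<comment> \<open>Weights do not matter for bijectivity, so the constant parameter 1 serves as a
      positive choice.\<close>
    obtain \<nu>1 t1' where r1: "(Ins 0 c1 t1, Done \<nu>1 t1') \<in> (run n \<mu>)\<^sup>*"
      "berele_insert c1 (tableau_of \<mu> t1) = tableau_of \<nu>1 t1'" "valid n \<mu> (Done \<nu>1 t1')"
      using berele_run[OF p x(2,3), of "\<lambda>_. 1"] by (metis zero_less_one)
    obtain \<nu>2 t2' where r2: "(Ins 0 c2 t2, Done \<nu>2 t2') \<in> (run n \<mu>)\<^sup>*"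
      "berele_insert c2 (tableau_of \<mu> t2) = tableau_of \<nu>2 t2'" "valid n \<mu> (Done \<nu>2 t2')"
      using berele_run[OF p y(2,3), of "\<lambda>_. 1"] by (metis zero_less_one)
    have "\<nu>1 = \<nu>2 \<and> t1' = t2'" using valid_eq[OF r1(3) r2(3)] r1(2) r2(2) e x y by simp
    then show "x = y" using run_start_unique[OF p r1(1), of c2 t2] r2(1) x y by simp
  next
    fix Q assume "Q \<in> (\<lambda>(c, P). berele_insert c P) ` (alphabet n \<times> tableaux n \<mu>)"
    then obtain c t where x: "Q = berele_insert c (tableau_of \<mu> t)" "c \<in> alphabet n" "filling n {} \<mu> t"
      by (auto simp: tableaux_iff[OF p])
    obtain \<nu> t' where "Q = tableau_of \<nu> t'" "valid n \<mu> (Done \<nu> t')"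
      using berele_run[OF p x(2,3), of "\<lambda>_. 1"] x(1) by (metis zero_less_one)
    then show "Q \<in> neighbour_tableaux n \<mu>"
      using symplectic_tableau_of[of \<nu> n t'] shape_tableau_of[of \<nu> t'] by (simp add: neighbour_tableaux_def)
  next
    fix Q assume Q: "Q \<in> neighbour_tableaux n \<mu>"
    then have s: "symplectic_tableau n Q" by (simp add: neighbour_tableaux_def)
    obtain t' where t': "filling n {} (shape Q) t'" "Q = tableau_of (shape Q) t'"
      using symplectic_is_tableau_of[OF s] by blast
    have v: "valid n \<mu> (Done (shape Q) t')"
      using Q t' by (simp add: neighbour_tableaux_def symplectic_tableau_def)
    \<comment> \<open>The preimage is where the backward run from \<open>Q\<close> ends; the
      invariant result along this run shows that inserting really gives \<open>Q\<close>.\<close>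
    obtain c t where c: "valid n \<mu> (Ins 0 c t)" "(Ins 0 c t, Done (shape Q) t') \<in> (run n \<mu>)\<^sup>*"
      using run_from_start[OF p n v] by blast
    have "Q = berele_insert c (tableau_of \<mu> t)"
      using run_invariants(1)[OF c(2) p, of "\<lambda>_. 1"] t'(2) by (simp add: berele_insert_def)
    moreover have "c \<in> alphabet n" "tableau_of \<mu> t \<in> tableaux n \<mu>"
      using c(1) by (auto simp: tableaux_iff[OF p])
    ultimately show "Q \<in> (\<lambda>(c, P). berele_insert c P) ` (alphabet n \<times> tableaux n \<mu>)" by force
  qed
qed

subsection \<open>The Markov property\<close>

lemma finite_alphabet: "finite (alphabet n)"
  by (simp add: alphabet_def)

lemma sum_letter_weight: "(\<Sum>c\<in>alphabet n. letter_weight a c) = letter_norm n a"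
proof -
  have "(\<Sum>c\<in>alphabet n. letter_weight a c)
      = (\<Sum>c\<in>Letter ` {1..n}. letter_weight a c) + (\<Sum>c\<in>Bar ` {1..n}. letter_weight a c)"
    unfolding alphabet_def by (rule sum.union_disjoint) auto
  also have "\<dots> = (\<Sum>i = 1..n. a i) + (\<Sum>i = 1..n. inverse (a i))"
    by (subst (1 2) sum.reindex) (auto simp: inj_on_def intro!: arg_cong2[where f="(+)"] sum.cong)
  finally show ?thesis by (simp add: letter_norm_def sum.distrib)
qed

lemma letter_prob_eq: "c \<in> alphabet n \<Longrightarrow> letter_prob n a c = letter_weight a c / letter_norm n a"
  by (auto simp: alphabet_def)

lemma finite_tableaux: "finite (tableaux n \<mu>)"
proof (cases "is_partition \<mu>")
  case True
  let ?rows = "{row. set row \<subseteq> alphabet n \<and> length row \<le> \<mu> 0}"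
  have "tableaux n \<mu> \<subseteq> {P. set P \<subseteq> ?rows \<and> length P \<le> num_rows \<mu>}"
  proof
    fix P assume "P \<in> tableaux n \<mu>"
    then obtain t where t: "filling n {} \<mu> t" "P = tableau_of \<mu> t" using tableaux_iff[OF True] by blast
    show "P \<in> {P. set P \<subseteq> ?rows \<and> length P \<le> num_rows \<mu>}"
      using t(2) filling_alphabet[OF t(1)] partition_mono[OF True, of 0]
      by (auto simp: tableau_of_def)
  qed
  then show ?thesis
    by (rule finite_subset) (intro finite_lists_length_le finite_alphabet)
next
  case False
  then have "tableaux n \<mu> = {}" by (auto simp: tableaux_def symplectic_tableau_def)
  then show ?thesis by simp
qed

section \<open>Symplectic Schur functions, the Pieri rule and the kernel\<close>

lemma symplectic_schur_eq: "symplectic_schur n \<mu> a = (\<Sum>P\<in>tableaux n \<mu>. tableau_weight n a P)"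
  by (simp add: symplectic_schur_def tableaux_def)

text \<open>Fill each row with its smallest admissible letter. This makes the Schur functions
  positive, so the kernel never divides by zero, and it realises every neighbouring partition as a
  shape.\<close>

lemma tableaux_nonempty:
  assumes "\<mu> \<in> partitions_upto n"
  shows "tableaux n \<mu> \<noteq> {}"
proof -
  have p: "is_partition \<mu>" and n: "\<And>i. 0 < \<mu> i \<Longrightarrow> i < n" using assms by (auto simp: partitions_upto_support)
  have "filling n {} \<mu> (\<lambda>(i, j). if j < \<mu> i then Letter (Suc i) else Letter 0)"
  proof (rule fillingI)
    fix i j assume "j < \<mu> i"
    then show "(case (i, j) of (i, j) \<Rightarrow> if j < \<mu> i then Letter (Suc i) else Letter 0) \<in> alphabet n"
      using n[of i] by (auto simp: alphabet_def)
  next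
    fix i i' j assume "i < i'" "j < \<mu> i'"
    then show "(case (i, j) of (i, j) \<Rightarrow> if j < \<mu> i then Letter (Suc i) else Letter 0)
      < (case (i', j) of (i, j) \<Rightarrow> if j < \<mu> i then Letter (Suc i) else Letter 0)"
      using partition_mono[OF p, of i i'] by (auto simp: less_letter_def)
  qed auto
  then show ?thesis using tableaux_iff[OF p] by blast
qed

lemma tableau_weight_pos: "(\<And>i. i \<in> {1..n} \<Longrightarrow> 0 < a i) \<Longrightarrow> 0 < tableau_weight n a P"
  by (auto simp: tableau_weight_def intro!: prod_pos zero_less_power_int)

lemma symplectic_schur_pos:
  assumes "\<And>i. i \<in> {1..n} \<Longrightarrow> 0 < a i" "\<mu> \<in> partitions_upto n"
  shows "0 < symplectic_schur n \<mu> a"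
  unfolding symplectic_schur_eq
  by (intro sum_pos finite_tableaux tableaux_nonempty tableau_weight_pos assms) auto

lemma finite_neighbour_tableaux:
  assumes "\<mu> \<in> partitions_upto n"
  shows "finite (neighbour_tableaux n \<mu>)"
  using bij_betw_finite[OF berele_bijection[OF assms]] finite_alphabet finite_tableaux by blast

text \<open>The factor \<open>letter_norm\<close> is the symplectic Schur function of a single box,
  so this is the Pieri rule for one box. Equivalently, Schur functions form a positive eigenfunction
  of the adjacency operator of one-box steps.\<close>

lemma symplectic_pieri:
  assumes a: "\<And>i. i \<in> {1..n} \<Longrightarrow> 0 < a i" and \<mu>: "\<mu> \<in> partitions_upto n"
  shows "(\<Sum>\<nu>\<in>shape ` neighbour_tableaux n \<mu>. symplectic_schur n \<nu> a) = letter_norm n a * symplectic_schur n \<mu> a"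
proof -
  have "(\<Sum>\<nu>\<in>shape ` neighbour_tableaux n \<mu>. symplectic_schur n \<nu> a)
    = (\<Sum>\<nu>\<in>shape ` neighbour_tableaux n \<mu>. \<Sum>Q\<in>{Q \<in> neighbour_tableaux n \<mu>. shape Q = \<nu>}. tableau_weight n a Q)"
    unfolding symplectic_schur_eq
    by (intro sum.cong refl) (auto simp: tableaux_def neighbour_tableaux_def)
  also have "\<dots> = (\<Sum>Q\<in>neighbour_tableaux n \<mu>. tableau_weight n a Q)"
    by (rule sum.image_gen[symmetric, OF finite_neighbour_tableaux[OF \<mu>]])
  also have "\<dots> = (\<Sum>x\<in>alphabet n \<times> tableaux n \<mu>. tableau_weight n a (case x of (c, P) \<Rightarrow> berele_insert c P))"
    by (rule sum.reindex_bij_betw[OF berele_bijection[OF \<mu>], symmetric])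
  also have "\<dots> = (\<Sum>(c, P)\<in>alphabet n \<times> tableaux n \<mu>. letter_weight a c * tableau_weight n a P)"
    by (intro sum.cong refl) (auto simp: tableaux_def intro!: berele_weight a)
  also have "\<dots> = letter_norm n a * symplectic_schur n \<mu> a"
    by (simp add: sum.cartesian_product[symmetric] sum_product[symmetric] sum_letter_weight symplectic_schur_eq)
  finally show ?thesis .
qed

text \<open>The kernel is the Doob transform of the adjacency operator by this eigenfunction, and
  row sums equal to 1 are the eigenvalue equation.\<close>

lemma shape_kernel_stochastic:
  assumes n: "1 \<le> n" and a: "\<And>i. i \<in> {1..n} \<Longrightarrow> 0 < a i"
  shows "stochastic_kernel_on (partitions_upto n) (shape_kernel n a)"
  unfolding stochastic_kernel_on_def
proof (intro ballI conjI)
  have Z: "0 < letter_norm n a"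
    unfolding letter_norm_def using n a by (intro sum_pos) (auto intro!: add_pos_pos)
  fix \<mu> assume \<mu>: "\<mu> \<in> partitions_upto n"
  show "0 \<le> shape_kernel n a \<mu> \<nu>" if "\<nu> \<in> partitions_upto n" for \<nu>
    using Z less_imp_le[OF symplectic_schur_pos[of n a, OF a \<mu>]]
      less_imp_le[OF symplectic_schur_pos[of n a, OF a that]] by (simp add: shape_kernel_def)
  let ?N = "shape ` neighbour_tableaux n \<mu>"
  show "(shape_kernel n a \<mu> has_sum 1) (partitions_upto n)"
  proof (rule has_sum_finite_neutralI)
    show "finite ?N" using finite_neighbour_tableaux[OF \<mu>] by simp
    show "?N \<subseteq> partitions_upto n" by (auto simp: neighbour_tableaux_def intro: shape_symplectic)
  next
    \<comment> \<open>Every admissible partition carries a tableau, so one that is not the shape of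
      a neighbouring tableau is not a neighbour of \<mu>.\<close>
    fix \<nu> assume \<nu>: "\<nu> \<in> partitions_upto n - ?N"
    then obtain Q where "Q \<in> tableaux n \<nu>" using tableaux_nonempty by blast
    then have "\<not> one_box_step \<mu> \<nu>" using \<nu> by (auto simp: tableaux_def neighbour_tableaux_def)
    then show "shape_kernel n a \<mu> \<nu> = 0" by (simp add: shape_kernel_def)
  next
    have "(\<Sum>\<nu>\<in>?N. shape_kernel n a \<mu> \<nu>)
      = (\<Sum>\<nu>\<in>?N. 1 / letter_norm n a * (symplectic_schur n \<nu> a / symplectic_schur n \<mu> a))"
      by (intro sum.cong refl) (auto simp: shape_kernel_def neighbour_tableaux_def)
    also have "\<dots> = 1 / letter_norm n a * ((\<Sum>\<nu>\<in>?N. symplectic_schur n \<nu> a) / symplectic_schur n \<mu> a)"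
      by (simp add: sum_distrib_left sum_divide_distrib)
    also have "\<dots> = 1"
      using Z symplectic_schur_pos[of n a, OF a \<mu>] symplectic_pieri[of n a, OF a \<mu>] by simp
    finally show "1 = (\<Sum>\<nu>\<in>?N. shape_kernel n a \<mu> \<nu>)" by simp
  qed
qed

section \<open>Tableaux along a word\<close>

lemma berele_tableau_cong:
  "(\<And>k. k \<in> {1..m} \<Longrightarrow> v k = v' k) \<Longrightarrow> berele_tableau v m = berele_tableau v' m"
  by (induction m) auto

lemma symplectic_Nil: "symplectic_tableau n []"
  by (auto simp: symplectic_tableau_def has_box_def shape_def is_partition_def antimono_def)

lemma berele_neighbour:
  assumes "symplectic_tableau n P" "c \<in> alphabet n"
  shows "berele_insert c P \<in> neighbour_tableaux n (shape P)"
  using bij_betwE[OF berele_bijection[OF shape_symplectic[OF assms(1)]]] assms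
  by (auto simp: tableaux_def)

lemma symplectic_berele_tableau:
  "(\<And>k. k \<in> {1..m} \<Longrightarrow> v k \<in> alphabet n) \<Longrightarrow> symplectic_tableau n (berele_tableau v m)"
  by (induction m) (use berele_neighbour in \<open>auto simp: symplectic_Nil neighbour_tableaux_def\<close>)

text \<open>The joint probability of a path of shapes and of its last tableau is the weight of the tableau
  times this constant, which depends on the path only: this is why the shapes alone are Markov.\<close>

primrec path_const :: "nat \<Rightarrow> (nat \<Rightarrow> real) \<Rightarrow> (nat \<Rightarrow> nat \<Rightarrow> nat) \<Rightarrow> nat \<Rightarrow> real" where
  "path_const n a x 0 = of_bool (x 0 = empty_partition)"
| "path_const n a x (Suc m) = path_const n a x m / letter_norm n a *
     of_bool (x m \<in> partitions_upto n \<and> one_box_step (x m) (x (Suc m)))"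

lemma path_const_cong: "(\<And>k. k \<le> m \<Longrightarrow> x k = x' k) \<Longrightarrow> path_const n a x m = path_const n a x' m"
  by (induction m) auto

section \<open>Probabilities of events depending on finitely many letters\<close>

locale random_word = prob_space M for M :: "'w measure" +
  fixes n :: nat and a :: "nat \<Rightarrow> real" and w :: "nat \<Rightarrow> 'w \<Rightarrow> letter"
  assumes a_pos: "\<And>i. i \<in> {1..n} \<Longrightarrow> 0 < a i"
    and indep: "indep_vars (\<lambda>_. count_space (alphabet n)) w {1..}"
    and letter_distr: "\<And>m c. 1 \<le> m \<Longrightarrow> c \<in> alphabet n \<Longrightarrow> \<P>(\<omega> in M. w m \<omega> = c) = letter_prob n a c"
begin

definition prefix_event :: "nat \<Rightarrow> (nat \<Rightarrow> letter) \<Rightarrow> 'w set" where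
  "prefix_event m v = {\<omega> \<in> space M. \<forall>k\<in>{1..m}. w k \<omega> = v k}"

lemma letter_measurable: "1 \<le> m \<Longrightarrow> w m \<in> measurable M (count_space (alphabet n))"
  using indep by (auto simp: indep_vars_def2)

lemma letter_in: "1 \<le> m \<Longrightarrow> \<omega> \<in> space M \<Longrightarrow> w m \<omega> \<in> alphabet n"
  using measurable_space[OF letter_measurable] by auto

lemma prefix_event:
  assumes v: "\<And>k. k \<in> {1..m} \<Longrightarrow> v k \<in> alphabet n"
  shows "prefix_event m v \<in> events" "prob (prefix_event m v) = (\<Prod>k\<in>{1..m}. letter_prob n a (v k))"
proof -
  have "prefix_event m v \<in> events \<and> prob (prefix_event m v) = (\<Prod>k\<in>{1..m}. letter_prob n a (v k))"
  \<comment> \<open>For \<open>m = 0\<close> the intersection over an empty index set would not be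
    \<open>space M\<close>.\<close>
  proof (cases "m = 0")
    case False
    have e: "prefix_event m v = (\<Inter>k\<in>{1..m}. w k -` {v k} \<inter> space M)"
      using False by (auto simp: prefix_event_def)
    have s: "w k -` {v k} \<inter> space M \<in> events" if "k \<in> {1..m}" for k
      using measurable_sets[OF letter_measurable, of k "{v k}"] v that by auto
    have "prob (\<Inter>k\<in>{1..m}. w k -` {v k} \<inter> space M) = (\<Prod>k\<in>{1..m}. prob (w k -` {v k} \<inter> space M))"
      using indep_varsD[OF indep, of "{1..m}" "\<lambda>k. {v k}"] v False by auto
    also have "\<dots> = (\<Prod>k\<in>{1..m}. letter_prob n a (v k))"
    proof (intro prod.cong refl)
      fix k assume k: "k \<in> {1..m}"
      have "w k -` {v k} \<inter> space M = {\<omega> \<in> space M. w k \<omega> = v k}" by auto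
      then show "prob (w k -` {v k} \<inter> space M) = letter_prob n a (v k)"
        using letter_distr[of k "v k"] k v by simp
    qed
    finally have "prob (prefix_event m v) = (\<Prod>k\<in>{1..m}. letter_prob n a (v k))" unfolding e .
    moreover have "prefix_event m v \<in> events"
      unfolding e by (rule sets.finite_INT) (use s False in auto)
    ultimately show ?thesis by simp
  qed (simp add: prefix_event_def prob_space)
  then show "prefix_event m v \<in> events" "prob (prefix_event m v) = (\<Prod>k\<in>{1..m}. letter_prob n a (v k))"
    by auto
qed

lemma prefix_event_disjoint:
  assumes "v \<in> PiE {1..m} A" "v' \<in> PiE {1..m} A'" "\<omega> \<in> prefix_event m v" "\<omega> \<in> prefix_event m v'"
  shows "v = v'"
proof
  fix k
  show "v k = v' k"
  proof (cases "k \<in> {1..m}")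
    case True
    then have "w k \<omega> = v k" "w k \<omega> = v' k" using assms(3,4) unfolding prefix_event_def by blast+
    then show ?thesis by (rule trans[OF sym])
  next
    case False
    then show ?thesis using PiE_arb[OF assms(1)] PiE_arb[OF assms(2)] by metis
  qed
qed

text \<open>Over a finite alphabet such properties define finite disjoint unions of prefix events,
  so their measurability and probabilities reduce to finite sums of products.\<close>

definition prefix_prop :: "nat \<Rightarrow> ((nat \<Rightarrow> letter) \<Rightarrow> bool) \<Rightarrow> bool" where
  "prefix_prop m Q \<longleftrightarrow> (\<forall>v v'. (\<forall>k\<in>{1..m}. v k = v' k) \<longrightarrow> Q v = Q v')"

text \<open>Extensional functions give each prefix exactly one representative, so that sums over
  this set count nothing twice.\<close>

definition prefixes :: "nat \<Rightarrow> ((nat \<Rightarrow> letter) \<Rightarrow> bool) \<Rightarrow> (nat \<Rightarrow> letter) set" where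
  "prefixes m Q = {v \<in> PiE {1..m} (\<lambda>_. alphabet n). Q v}"

lemma finite_prefixes: "finite (prefixes m Q)"
  unfolding prefixes_def by (rule finite_subset[of _ "PiE {1..m} (\<lambda>_. alphabet n)"])
    (auto intro: finite_PiE finite_alphabet)

lemma prefix_prop_Union:
  assumes Q: "prefix_prop m Q"
  shows "{\<omega> \<in> space M. Q (\<lambda>k. w k \<omega>)} = (\<Union>v\<in>prefixes m Q. prefix_event m v)"
proof (intro set_eqI iffI)
  fix \<omega> assume \<omega>: "\<omega> \<in> {\<omega> \<in> space M. Q (\<lambda>k. w k \<omega>)}"
  let ?v = "restrict (\<lambda>k. w k \<omega>) {1..m}"
  have "Q ?v" using \<omega> Q unfolding prefix_prop_def by (metis (mono_tags, lifting) mem_Collect_eq restrict_apply')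
  then have "?v \<in> prefixes m Q" using letter_in \<omega> by (auto simp: prefixes_def)
  moreover have "\<omega> \<in> prefix_event m ?v" using \<omega> by (simp add: prefix_event_def)
  ultimately show "\<omega> \<in> (\<Union>v\<in>prefixes m Q. prefix_event m v)" by blast
next
  fix \<omega> assume "\<omega> \<in> (\<Union>v\<in>prefixes m Q. prefix_event m v)"
  then obtain v where "Q v" "\<omega> \<in> space M" "\<forall>k\<in>{1..m}. w k \<omega> = v k"
    by (auto simp: prefixes_def prefix_event_def)
  then show "\<omega> \<in> {\<omega> \<in> space M. Q (\<lambda>k. w k \<omega>)}"
    using Q unfolding prefix_prop_def by (metis (mono_tags, lifting) mem_Collect_eq)
qed

lemma prefix_prop_event:
  assumes Q: "prefix_prop m Q"
  shows "{\<omega> \<in> space M. Q (\<lambda>k. w k \<omega>)} \<in> events"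
    and "\<P>(\<omega> in M. Q (\<lambda>k. w k \<omega>)) = (\<Sum>v\<in>prefixes m Q. \<Prod>k\<in>{1..m}. letter_prob n a (v k))"
proof -
  have v: "v k \<in> alphabet n" if "v \<in> prefixes m Q" "k \<in> {1..m}" for v k
    using that by (auto simp: prefixes_def)
  show "{\<omega> \<in> space M. Q (\<lambda>k. w k \<omega>)} \<in> events"
    unfolding prefix_prop_Union[OF Q] using prefix_event(1) v finite_prefixes by (intro sets.finite_UN) auto
  have "disjoint_family_on (prefix_event m) (prefixes m Q)"
    unfolding disjoint_family_on_def prefixes_def
  proof (intro ballI impI equals0I)
    fix v v' \<omega>
    assume "v \<in> {v \<in> PiE {1..m} (\<lambda>_. alphabet n). Q v}" "v' \<in> {v \<in> PiE {1..m} (\<lambda>_. alphabet n). Q v}"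
      and ne: "v \<noteq> v'" and \<omega>: "\<omega> \<in> prefix_event m v \<inter> prefix_event m v'"
    then have "v \<in> PiE {1..m} (\<lambda>_. alphabet n)" "v' \<in> PiE {1..m} (\<lambda>_. alphabet n)" by blast+
    from prefix_event_disjoint[OF this] \<omega> ne show False by blast
  qed
  then have "prob (\<Union>v\<in>prefixes m Q. prefix_event m v) = (\<Sum>v\<in>prefixes m Q. prob (prefix_event m v))"
    using prefix_event(1) v finite_prefixes by (intro finite_measure_finite_Union) auto
  then show "\<P>(\<omega> in M. Q (\<lambda>k. w k \<omega>)) = (\<Sum>v\<in>prefixes m Q. \<Prod>k\<in>{1..m}. letter_prob n a (v k))"
    unfolding prefix_prop_Union[OF Q] using prefix_event(2) v by (simp cong: sum.cong)
qed

text \<open>This is the independence of the past and the next letter: in the sum over prefixes of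
  length \<open>Suc m\<close> the last factor is constant and comes out.\<close>

lemma prob_prefix_prop_next:
  assumes Q: "prefix_prop m Q" and c: "c \<in> alphabet n"
  shows "\<P>(\<omega> in M. Q (\<lambda>k. w k \<omega>) \<and> w (Suc m) \<omega> = c) = \<P>(\<omega> in M. Q (\<lambda>k. w k \<omega>)) * letter_prob n a c"
proof -
  let ?R = "\<lambda>v. Q v \<and> v (Suc m) = c"
  have R: "prefix_prop (Suc m) ?R"
    unfolding prefix_prop_def
  proof (intro allI impI)
    fix v v' :: "nat \<Rightarrow> letter" assume e: "\<forall>k\<in>{1..Suc m}. v k = v' k"
    then have "Q v = Q v'" using Q unfolding prefix_prop_def by (meson atLeastAtMost_iff le_Suc_eq)
    then show "?R v = ?R v'" using e by auto
  qed
  have Qu: "Q (v(Suc m := x)) = Q v" for v x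
    using Q unfolding prefix_prop_def by (metis atLeastAtMost_iff fun_upd_apply not_less_eq_eq order_refl)
  have bij: "bij_betw (\<lambda>v. v(Suc m := c)) (prefixes m Q) (prefixes (Suc m) ?R)"
  \<comment> \<open>Dropping the last letter means resetting it to \<open>undefined\<close>, the
    value of extensional functions outside their domain.\<close>
  proof (rule bij_betwI[where g = "\<lambda>v. v(Suc m := undefined)"])
    show "(\<lambda>v. v(Suc m := c)) \<in> prefixes m Q \<rightarrow> prefixes (Suc m) ?R"
      using c by (auto simp: prefixes_def Qu PiE_def extensional_def Pi_def)
    show "(\<lambda>v. v(Suc m := undefined)) \<in> prefixes (Suc m) ?R \<rightarrow> prefixes m Q"
      by (auto simp: prefixes_def Qu PiE_def extensional_def Pi_def)
    show "v(Suc m := c, Suc m := undefined) = v" if "v \<in> prefixes m Q" for v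
      using that by (auto simp: prefixes_def PiE_def extensional_def)
    show "v(Suc m := undefined, Suc m := c) = v" if "v \<in> prefixes (Suc m) ?R" for v
      using that by (auto simp: prefixes_def)
  qed
  have "\<P>(\<omega> in M. Q (\<lambda>k. w k \<omega>) \<and> w (Suc m) \<omega> = c)
      = (\<Sum>v\<in>prefixes (Suc m) ?R. \<Prod>k\<in>{1..Suc m}. letter_prob n a (v k))"
    using prefix_prop_event(2)[OF R] .
  also have "\<dots> = (\<Sum>v\<in>prefixes m Q. \<Prod>k\<in>{1..Suc m}. letter_prob n a ((v(Suc m := c)) k))"
    by (rule sum.reindex_bij_betw[OF bij, symmetric])
  also have "\<dots> = (\<Sum>v\<in>prefixes m Q. (\<Prod>k\<in>{1..m}. letter_prob n a (v k)) * letter_prob n a c)"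
    by (intro sum.cong refl) (simp add: prod.cl_ivl_Suc)
  also have "\<dots> = \<P>(\<omega> in M. Q (\<lambda>k. w k \<omega>)) * letter_prob n a c"
    unfolding prefix_prop_event(2)[OF Q] by (simp add: sum_distrib_right)
  finally show ?thesis .
qed

section \<open>Path probabilities and the transition law of the shapes\<close>

abbreviation T :: "nat \<Rightarrow> 'w \<Rightarrow> tableau" where
  "T m \<omega> \<equiv> berele_tableau (\<lambda>k. w k \<omega>) m"

text \<open>A property of words rather than of outcomes, so that it can be recognised as depending
  on a prefix only.\<close>

definition follows :: "(nat \<Rightarrow> nat \<Rightarrow> nat) \<Rightarrow> nat \<Rightarrow> (nat \<Rightarrow> letter) \<Rightarrow> bool" where
  "follows x m v \<longleftrightarrow> (\<forall>k\<le>m. shape (berele_tableau v k) = x k)"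

lemma prefix_prop_follows:
  "prefix_prop m (follows x m)" "prefix_prop m (\<lambda>v. follows x m v \<and> berele_tableau v m = P)"
  "prefix_prop m (\<lambda>v. shape (berele_tableau v m) \<in> A)"
proof -
  have e: "follows x m v = follows x m v' \<and> berele_tableau v m = berele_tableau v' m"
    if "\<forall>k\<in>{1..m}. v k = v' k" for v v'
  proof -
    have "berele_tableau v k = berele_tableau v' k" if k: "k \<le> m" for k
      by (rule berele_tableau_cong) (use k \<open>\<forall>k\<in>{1..m}. v k = v' k\<close> in auto)
    then show ?thesis by (simp add: follows_def)
  qed
  show "prefix_prop m (follows x m)" unfolding prefix_prop_def using e by blast
  show "prefix_prop m (\<lambda>v. follows x m v \<and> berele_tableau v m = P)"
    unfolding prefix_prop_def
  proof (intro allI impI)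
    fix v v' :: "nat \<Rightarrow> letter" assume "\<forall>k\<in>{1..m}. v k = v' k"
    from e[OF this] show "(follows x m v \<and> berele_tableau v m = P) = (follows x m v' \<and> berele_tableau v' m = P)"
      by simp
  qed
  show "prefix_prop m (\<lambda>v. shape (berele_tableau v m) \<in> A)"
    unfolding prefix_prop_def
  proof (intro allI impI)
    fix v v' :: "nat \<Rightarrow> letter" assume "\<forall>k\<in>{1..m}. v k = v' k"
    from e[OF this] show "(shape (berele_tableau v m) \<in> A) = (shape (berele_tableau v' m) \<in> A)"
      by simp
  qed
qed

lemma T_symplectic: "\<omega> \<in> space M \<Longrightarrow> symplectic_tableau n (T m \<omega>)"
  by (rule symplectic_berele_tableau) (auto intro: letter_in)

text \<open>In a possible step the bijection gives \<open>P\<close> a unique origin, a tableau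
  \<open>R\<close> of shape \<open>x m\<close> and a letter \<open>c\<close>, so no sum over
  predecessors arises. The weights of \<open>R\<close> and \<open>c\<close> multiply to that of
  \<open>P\<close>, which leaves one factor \<open>1 / letter_norm n a\<close> per step.\<close>

lemma prob_path_tableau:
  assumes "P \<in> tableaux n (x m)"
  shows "\<P>(\<omega> in M. follows x m (\<lambda>k. w k \<omega>) \<and> T m \<omega> = P) = path_const n a x m * tableau_weight n a P"
  using assms
proof (induction m arbitrary: P)
  case 0
  have s: "shape [] = empty_partition" by (auto simp: shape_def empty_partition_def)
  have [simp]: "tableau_weight n a [] = 1" by (simp add: tableau_weight_def)
  show ?case
  proof (cases "x 0 = empty_partition")
    case True
    have p: "is_partition empty_partition" by (simp add: empty_partition_def is_partition_def antimono_def)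
    have "P = []" using 0 True tableaux_iff[OF p, of P n]
      by (auto simp: tableau_of_def num_rows_def empty_partition_def)
    then show ?thesis using True s by (simp add: follows_def prob_space)
  next
    case False
    then have "\<not> follows x 0 v" for v using s by (auto simp: follows_def)
    then show ?thesis using False by simp
  qed
next
  case (Suc m)
  have P: "symplectic_tableau n P" "shape P = x (Suc m)" using Suc.prems by (auto simp: tableaux_def)
  let ?E = "\<lambda>\<omega>. follows x (Suc m) (\<lambda>k. w k \<omega>) \<and> T (Suc m) \<omega> = P"
  have E: "?E \<omega> \<longleftrightarrow> follows x m (\<lambda>k. w k \<omega>) \<and> berele_insert (w (Suc m) \<omega>) (T m \<omega>) = P" for \<omega>
    using P by (auto simp: follows_def le_Suc_eq)
  have T: "T m \<omega> \<in> tableaux n (x m)" "x m \<in> partitions_upto n" "w (Suc m) \<omega> \<in> alphabet n"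
    if "\<omega> \<in> space M" "follows x m (\<lambda>k. w k \<omega>)" for \<omega>
    using that T_symplectic[OF that(1), of m] letter_in[OF _ that(1), of "Suc m"] shape_symplectic[OF T_symplectic[OF that(1), of m]]
    by (auto simp: tableaux_def follows_def)
  show ?case
  proof (cases "x m \<in> partitions_upto n \<and> one_box_step (x m) (x (Suc m))")
    case True
    have bij: "bij_betw (\<lambda>(c, P). berele_insert c P) (alphabet n \<times> tableaux n (x m)) (neighbour_tableaux n (x m))"
      using berele_bijection True by blast
    have "P \<in> neighbour_tableaux n (x m)" using P True by (simp add: neighbour_tableaux_def)
    then obtain c R where R: "c \<in> alphabet n" "R \<in> tableaux n (x m)" "berele_insert c R = P"
      using bij_betw_imp_surj_on[OF bij] by force
    have "{\<omega> \<in> space M. ?E \<omega>} = {\<omega> \<in> space M. (follows x m (\<lambda>k. w k \<omega>) \<and> T m \<omega> = R) \<and> w (Suc m) \<omega> = c}"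
    proof (rule Collect_cong, rule conj_cong[OF refl])
      fix \<omega> assume \<omega>: "\<omega> \<in> space M"
      have "w (Suc m) \<omega> = c \<and> T m \<omega> = R" if "follows x m (\<lambda>k. w k \<omega>)" "berele_insert (w (Suc m) \<omega>) (T m \<omega>) = P"
        using inj_onD[OF bij_betw_imp_inj_on[OF bij], of "(w (Suc m) \<omega>, T m \<omega>)" "(c, R)"] T[OF \<omega> that(1)] R that
        by auto
      then show "?E \<omega> \<longleftrightarrow> (follows x m (\<lambda>k. w k \<omega>) \<and> T m \<omega> = R) \<and> w (Suc m) \<omega> = c"
        unfolding E using R by auto
    qed
    then have "\<P>(\<omega> in M. ?E \<omega>) = path_const n a x m * tableau_weight n a R * letter_prob n a c"
      using prob_prefix_prop_next[OF prefix_prop_follows(2) R(1)] Suc.IH[OF R(2)] by simp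
    also have "\<dots> = path_const n a x (Suc m) * tableau_weight n a P"
      using berele_weight[of n R c a] R a_pos True by (auto simp: letter_prob_eq tableaux_def)
    finally show ?thesis .
  next
    case False
    have "\<not> ?E \<omega>" if "\<omega> \<in> space M" for \<omega>
    proof
      assume e: "?E \<omega>"
      then have f: "follows x m (\<lambda>k. w k \<omega>)" "berele_insert (w (Suc m) \<omega>) (T m \<omega>) = P" using E by auto
      have "one_box_step (x m) (x (Suc m))"
        using berele_neighbour[of n "T m \<omega>" "w (Suc m) \<omega>"] T[OF that f(1)] f(2) P
        by (auto simp: tableaux_def neighbour_tableaux_def)
      then show False using False T[OF that f(1)] by simp
    qed
    then have "{\<omega> \<in> space M. ?E \<omega>} = {}" by blast
    then have "\<P>(\<omega> in M. ?E \<omega>) = 0" by (simp only: measure_empty)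
    moreover have "path_const n a x (Suc m) = 0" using False by simp
    ultimately show ?thesis by (simp only: mult_zero_left)
  qed
qed

text \<open>Summing out the last tableau turns its weight into the Schur function of the last
  shape.\<close>

lemma prob_path: "\<P>(\<omega> in M. follows x m (\<lambda>k. w k \<omega>)) = path_const n a x m * symplectic_schur n (x m) a"
proof -
  let ?E = "\<lambda>P. {\<omega> \<in> space M. follows x m (\<lambda>k. w k \<omega>) \<and> T m \<omega> = P}"
  have "{\<omega> \<in> space M. follows x m (\<lambda>k. w k \<omega>)} = (\<Union>P\<in>tableaux n (x m). ?E P)"
    using T_symplectic by (auto simp: tableaux_def follows_def)
  moreover have "prob (\<Union>P\<in>tableaux n (x m). ?E P) = (\<Sum>P\<in>tableaux n (x m). prob (?E P))"
    using prefix_prop_event(1)[OF prefix_prop_follows(2)]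
    by (intro finite_measure_finite_Union) (auto simp: finite_tableaux disjoint_family_on_def)
  ultimately show ?thesis
    by (simp add: prob_path_tableau sum_distrib_left symplectic_schur_eq)
qed

lemma shape_measurable: "(\<lambda>\<omega>. shape (T m \<omega>)) \<in> measurable M (count_space (partitions_upto n))"
proof (rule measurableI)
  fix A :: "(nat \<Rightarrow> nat) set"
  have "(\<lambda>\<omega>. shape (T m \<omega>)) -` A \<inter> space M = {\<omega> \<in> space M. shape (T m \<omega>) \<in> A}" by auto
  then show "(\<lambda>\<omega>. shape (T m \<omega>)) -` A \<inter> space M \<in> events"
    using prefix_prop_event(1)[OF prefix_prop_follows(3), of m A] by simp
qed (use shape_symplectic[OF T_symplectic] in auto)

text \<open>In the quotient of two path probabilities the constant of the common past cancels; the
  ratio of Schur functions and one factor \<open>1 / letter_norm n a\<close> remain.\<close>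

lemma shape_transition:
  assumes pos: "0 < \<P>(\<omega> in M. \<forall>k\<le>m. shape (T k \<omega>) = x k)"
  shows "\<P>(\<omega> in M. shape (T (Suc m) \<omega>) = y \<bar> \<forall>k\<le>m. shape (T k \<omega>) = x k) = shape_kernel n a (x m) y"
proof -
  let ?x = "x(Suc m := y)"
  have pos': "0 < path_const n a x m * symplectic_schur n (x m) a"
    using pos prob_path[of x m] by (simp add: follows_def)
  \<comment> \<open>Otherwise no tableau has shape \<open>x m\<close>, its Schur function is an
    empty sum, and the conditioning event would be null.\<close>
  have xm: "x m \<in> partitions_upto n"
  proof (rule ccontr)
    assume "x m \<notin> partitions_upto n"
    then have "tableaux n (x m) = {}" by (auto simp: tableaux_def dest: shape_symplectic)
    then show False using pos' by (simp add: symplectic_schur_eq)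
  qed
  have "{\<omega> \<in> space M. shape (T (Suc m) \<omega>) = y \<and> (\<forall>k\<le>m. shape (T k \<omega>) = x k)}
      = {\<omega> \<in> space M. follows ?x (Suc m) (\<lambda>k. w k \<omega>)}"
    by (auto simp: follows_def le_Suc_eq)
  then have "\<P>(\<omega> in M. shape (T (Suc m) \<omega>) = y \<and> (\<forall>k\<le>m. shape (T k \<omega>) = x k))
      = path_const n a x m / letter_norm n a * of_bool (one_box_step (x m) y) * symplectic_schur n y a"
    using prob_path[of ?x "Suc m"] xm path_const_cong[of m ?x x n a] by simp
  then show ?thesis
    unfolding cond_prob_def using prob_path[of x m] pos'
    by (auto simp: follows_def shape_kernel_def)
qed

end

theorem theorem2:
  fixes n :: nat and a :: "nat \<Rightarrow> real"
    and M :: "'w measure" and w :: "nat \<Rightarrow> 'w \<Rightarrow> letter"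
  assumes "1 \<le> n"
    and "\<And>i. i \<in> {1..n} \<Longrightarrow> 0 < a i"
    and "prob_space M"
    and "prob_space.indep_vars M (\<lambda>_. count_space (alphabet n)) w {1..}"
    and "\<And>m x. 1 \<le> m \<Longrightarrow> x \<in> alphabet n \<Longrightarrow> \<P>(\<omega> in M. w m \<omega> = x) = letter_prob n a x"
  shows "markov_chain_on M (partitions_upto n) (shape_kernel n a) empty_partition
           (\<lambda>m \<omega>. shape (berele_tableau (\<lambda>k. w k \<omega>) m))"
proof -
  interpret prob_space M by fact
  interpret random_word M n a w by unfold_locales (use assms in auto)
  have "shape [] = empty_partition" by (auto simp: shape_def empty_partition_def)
  then show ?thesis
    unfolding markov_chain_on_def
    using shape_kernel_stochastic[of n a, OF assms(1,2)] shape_measurable shape_transition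
    by (auto simp: prob_space)
qed

end
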